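(* Let $X=\mathbb R^d$, $d\ge2$, and let $Q,\eta$ be as in the context. Let $K_1,K_2$ be continuous linear operators in the real space $\mathscr H=L^2(X,m)$ which commute with every operator $(M_\psi f)(x)=\psi(x^1)f(x)$, $\psi:\mathbb R\to\mathbb R$ bounded measurable, and satisfy $K_2^*K_2=\mathbf 1+\eta K_1^*K_1$; extend them by linearity to $\mathscr H_{\mathbb C}$ and put $T=K_1^*K_1$. Let $\tau(a)=(a\Omega,\Omega)_{\mathscr F^{JQ}(L^2(Z,m))}$ be the vacuum state on the algebra $\mathbf A$ generated by the operators $\mathfrak I^{(k)}_{\sharp_1,\dots,\sharp_k}(h_1,\dots,h_k,v^{(k)})$ defined in the context, and let $\mathbf S^{(n,n)}$ be its $n$-point functions. Let $v^{(2n)}:\mathbb R^{2n}\to\mathbb C$ be identically equal to $1$. Then, for any $g_1,\dots,g_n,h_1,\dots,h_n\in\mathscr H_{\mathbb C}$, $$\mathbf S^{(n,n)}(g_n,\dots,g_1,h_1,\dots,h_n,1)=\sum_{\pi\in S_n}\int_{X^n}\Big(\prod_{i=1}^ng_i(x_i)(Th_{\pi(i)})(x_i)\Big)Q_\pi(x_1,\dots,x_n)\,m^{\otimes n}(dx_1\cdots dx_n).$$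
   Context: $m$ is the Lebesgue measure on $X=\mathbb R^d$, $d\ge2$; $x^i$ is the $i$-th coordinate of $x$; $\mathscr H=L^2(X,m)$ (real-valued), $\mathscr H_{\mathbb C}=L^2(X\to\mathbb C,m)$. $\Delta=\{(x,y)\in X^2: x^1=y^1\}$. $Q:X^2\to\mathbb C$ is a measurable function depending only on $(x^1,y^1)$, with $|Q(x,y)|=1$ and $Q(x,y)=\overline{Q(y,x)}$ off $\Delta$, and $Q(x,y)=\eta$ on $\Delta$, where $\eta\in\mathbb R$ is a constant. For $\pi\in S_n$, $Q_\pi(x_1,\dots,x_n)=\prod_{i<j,\ \pi(i)>\pi(j)}Q(x_i,x_j)$. Measures. For signs $\sharp_1,\dots,\sharp_k\in\{+,-\}$ let $\Pi(k,\sharp_1,\dots,\sharp_k)$ be the set of partitions $\theta$ of $\{1,\dots,k\}$ all of whose blocks have at most two elements and such that $\sharp_a\ne\sharp_b$ whenever $\{a,b\}$ is a two-element block. For a non-atomic measure $\mu$ on a space $Y$ and $\theta=\{\theta_1,\dots,\theta_l\}$ with $\min\theta_1<\dots<\min\theta_l$, let $\mu^{(k)}_\theta$ be the pushforward of $\mu^{\otimes l}$ under $Y^l\ni(y_1,\dots,y_l)\mapsto(z_1,\dots,z_k)\in Y^k$, $z_i=y_j$ for $i\in\theta_j$; put $\mu^{(k)}_{\sharp_1,\dots,\sharp_k}=\sum_{\theta\in\Pi(k,\sharp_1,\dots,\sharp_k)}\mu^{(k)}_\theta$. For $\mu=m$ this gives $m^{(k)}_{\sharp_1,\dots,\sharp_k}$;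 for $\mu$ the Lebesgue measure on $\mathbb R$ it gives $\nu^{(k)}_{\sharp_1,\dots,\sharp_k}$ on $\mathbb R^k$. The space $Z$ and the function $JQ$. $Z=X_1\sqcup X_2$ is the disjoint union of two copies $X_1,X_2$ of $X$; $m$ also denotes the measure on $Z$ whose restriction to each copy is $m$, so $L^2(Z\to\mathbb C,m)=\mathscr H_{\mathbb C}\oplus\mathscr H_{\mathbb C}$. $JQ:Z^2\to\mathbb C$ is $JQ(x,y)=Q(x,y)$ if $x,y$ lie in the same copy, and $JQ(x,y)=Q(y,x)$ if they lie in different copies (on the right, points of $Z$ are identified with the corresponding points of $X$). The $JQ$-Fock space and its operator-valued integrals. Write $R=JQ$, $Y=Z$. For $\pi\in S_n$ let $R_\pi(x_1,\dots,x_n)=\prod_{i<j,\ \pi(i)>\pi(j)}R(x_i,x_j)$ and $(P_nf)(x_1,\dots,x_n)=\frac1{n!}\sum_{\pi\in S_n}R_\pi(x_1,\dots,x_n)f(x_{\pi^{-1}(1)},\dots,x_{\pi^{-1}(n)})$; $P_n$ is the orthogonal projection of $L^2(Y^n\to\mathbb C,m^{\otimes n})$ onto the subspace $\mathscr H_n$ of $R$-symmetric functions, i.e. $f(x_1,\dots,x_n)=R(x_i,x_{i+1})f(x_1,\dots,x_{i+1},x_i,\dots,x_n)$ a.e. for all $i$; $\mathscr H_0=\mathbb C$, $P_0=\mathrm{id}$. $\mathscr F^{R}(L^2(Y,m))$ is the Hilbert space of sequences $(f^{(n)})_{n\ge0}$, $f^{(n)}\in\mathscr H_n$, with squared norm $\sum_n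 n!\|f^{(n)}\|^2$; $\Omega=(1,0,0,\dots)$; $\mathscr F^R_{\mathrm{fin}}(L^2(Y,m))$ is the subspace of finite sequences. For signs $\sharp_1,\dots,\sharp_k$, $g_1,\dots,g_k\in L^2(Y\to\mathbb C,m)$ and $\varkappa\in L^\infty(Y^k\to\mathbb C,m^{(k)}_{\sharp_1,\dots,\sharp_k})$, put $\varphi(y_1,\dots,y_k)=g_1(y_1)\cdots g_k(y_k)\varkappa(y_1,\dots,y_k)$ and define the operator $I^{(k)}_{\sharp_1,\dots,\sharp_k}(g_1,\dots,g_k,\varkappa)$ on $f\in\mathscr H_n$ as follows. Start with the word of variables $(t_1,\dots,t_n)$. For $j=k,k-1,\dots,1$ successively: if $\sharp_j=+$, put a new letter $y_j$ at the front of the current word; if $\sharp_j=-$, choose a letter $z$ of the current word, delete it, set $y_j:=z$, and record the factor $\prod_uR(z,u)$ over the letters $u$ preceding $z$ in the current word. A history $c$ is a complete sequence of such choices (none exists if a deletion from an empty word is required). The final word has length $n'$; $(I_cf)(x_1,\dots,x_{n'})$ is the integral, with respect to $m$ in each deleted letter, of $\varphi(y_1,\dots,y_k)f(t_1,\dots,t_n)$ times all recorded factors, where the letters of the final word are set equal to $x_1,\dots,x_{n'}$ in order. Then $I^{(k)}_{\sharp_1,\dots,\sharp_k}(g_1,\dots,g_k,\varkappa)f:=P_{n'}\sum_cI_cf$, extended linearly to $\mathscr F^R_{\mathrm{fin}}$. (For $\varkappa\equiv1$ this is the product of the operators $\int g_j\partial^{\sharp_j}$, where $\int g\,\partial^+=a^+(g)$,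 $a^+(g)f=P_{n+1}(g\otimes f)$, and $\int g\,\partial^-=a^-(\bar g)=(a^+(\bar g))^*$.) The operators $\mathfrak I^{(k)}$. $\mathscr K_1h=(K_1h,0)$, $\mathscr K_2h=(0,K_2h)$; $s(1,+)=-$, $s(2,+)=+$, $s(1,-)=+$, $s(2,-)=-$; $(\mathscr R^{(k)}_{i_1,\dots,i_k}v^{(k)})(x_1,\dots,x_k)=v^{(k)}(x_1^1,\dots,x_k^1)$ on $X_{i_1}\times\dots\times X_{i_k}$ and $0$ otherwise. For $h_1,\dots,h_k\in\mathscr H_{\mathbb C}$ and $v^{(k)}\in L^\infty(\mathbb R^k\to\mathbb C,\nu^{(k)}_{\sharp_1,\dots,\sharp_k})$, $$\mathfrak I^{(k)}_{\sharp_1,\dots,\sharp_k}(h_1,\dots,h_k,v^{(k)}):=\sum_{(i_1,\dots,i_k)\in\{1,2\}^k}I^{(k)}_{s(i_1,\sharp_1),\dots,s(i_k,\sharp_k)}(\mathscr K_{i_1}h_1,\dots,\mathscr K_{i_k}h_k,\mathscr R^{(k)}_{i_1,\dots,i_k}v^{(k)}).$$ $n$-point functions: $\mathbf S^{(n,n)}(h_1,\dots,h_{2n},v^{(2n)}):=\tau\big(\mathfrak I^{(2n)}_{\sharp_1,\dots,\sharp_{2n}}(h_1,\dots,h_{2n},v^{(2n)})\big)$ with $\sharp_1=\dots=\sharp_n=+$, $\sharp_{n+1}=\dots=\sharp_{2n}=-$. *)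

theory Defs
  imports "HOL-Analysis.Analysis" "HOL-Combinatorics.Permutations" "HOL-Library.Disjoint_Sets"
begin

section \<open>Square-integrable and essentially bounded functions\<close>

text \<open>
  Elements of $L^2$ and $L^\infty$ are represented by measurable functions, and equality in these
  spaces is almost-everywhere equality. Correspondingly, an operator in the real space $L^2(M)$
  is given by its action on representatives.
\<close>

definition L2 :: "'a measure \<Rightarrow> ('a \<Rightarrow> 'b::real_normed_vector) set" where
  "L2 M = {f \<in> borel_measurable M. integrable M (\<lambda>x. (norm (f x))\<^sup>2)}"

definition L2_norm :: "'a measure \<Rightarrow> ('a \<Rightarrow> 'b::real_normed_vector) \<Rightarrow> real" where
  "L2_norm M f = sqrt (LINT x|M. (norm (f x))\<^sup>2)"

definition Linfty :: "'a measure \<Rightarrow> ('a \<Rightarrow> 'b::real_normed_vector) set" where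
  "Linfty M = {f \<in> borel_measurable M. \<exists>C. AE x in M. norm (f x) \<le> C}"

definition L2_operator :: "'a measure \<Rightarrow> (('a \<Rightarrow> real) \<Rightarrow> ('a \<Rightarrow> real)) \<Rightarrow> bool" where
  "L2_operator M K \<longleftrightarrow>
     (\<forall>f\<in>L2 M. K f \<in> L2 M) \<and>
     (\<forall>f\<in>L2 M. \<forall>g\<in>L2 M. (AE x in M. f x = g x) \<longrightarrow> (AE x in M. K f x = K g x)) \<and>
     (\<forall>f\<in>L2 M. \<forall>g\<in>L2 M. AE x in M. K (\<lambda>y. f y + g y) x = K f x + K g x) \<and>
     (\<forall>r. \<forall>f\<in>L2 M. AE x in M. K (\<lambda>y. r * f y) x = r * K f x) \<and>
     (\<exists>C. \<forall>f\<in>L2 M. L2_norm M (K f) \<le> C * L2_norm M f)"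

definition L2_is_adjoint ::
    "'a measure \<Rightarrow> (('a \<Rightarrow> real) \<Rightarrow> ('a \<Rightarrow> real)) \<Rightarrow> (('a \<Rightarrow> real) \<Rightarrow> ('a \<Rightarrow> real)) \<Rightarrow> bool" where
  "L2_is_adjoint M K K' \<longleftrightarrow> L2_operator M K' \<and>
     (\<forall>f\<in>L2 M. \<forall>g\<in>L2 M. (LINT x|M. K f x * g x) = (LINT x|M. f x * K' g x))"

text \<open>As for the constant \<^const>\<open>adjoint\<close>, the adjoint is picked by its defining property; it exists
  (lemma \<open>L2_adjoint\<close> below) and is unique up to almost-everywhere equality.\<close>

definition L2_adjoint ::
    "'a measure \<Rightarrow> (('a \<Rightarrow> real) \<Rightarrow> ('a \<Rightarrow> real)) \<Rightarrow> (('a \<Rightarrow> real) \<Rightarrow> ('a \<Rightarrow> real))" where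
  "L2_adjoint M K = (SOME K'. L2_is_adjoint M K K')"

definition complexify :: "(('a \<Rightarrow> real) \<Rightarrow> ('a \<Rightarrow> real)) \<Rightarrow> ('a \<Rightarrow> complex) \<Rightarrow> ('a \<Rightarrow> complex)" where
  "complexify K h =
     (\<lambda>x. complex_of_real (K (\<lambda>y. Re (h y)) x) + \<i> * complex_of_real (K (\<lambda>y. Im (h y)) x))"

subsection \<open>Existence of adjoints\<close>

lemma L2_real: "(f :: 'a \<Rightarrow> real) \<in> L2 M \<longleftrightarrow> f \<in> borel_measurable M \<and> integrable M (\<lambda>x. (f x)\<^sup>2)"
  by (simp add: L2_def)

lemma L2_mult_integrable:
  fixes f g :: "'a \<Rightarrow> real"
  assumes "f \<in> L2 M" "g \<in> L2 M"
  shows "integrable M (\<lambda>x. f x * g x)"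
proof (rule Bochner_Integration.integrable_bound)
  show "integrable M (\<lambda>x. (f x)\<^sup>2 + (g x)\<^sup>2)"
    using assms by (auto simp: L2_real)
  show "(\<lambda>x. f x * g x) \<in> borel_measurable M"
    using assms by (auto simp: L2_real)
  have "\<bar>a * b\<bar> \<le> \<bar>a\<^sup>2 + b\<^sup>2\<bar>" for a b :: real
  proof -
    have "2 * (\<bar>a\<bar> * \<bar>b\<bar>) \<le> a\<^sup>2 + b\<^sup>2"
      using sum_squares_bound[of "\<bar>a\<bar>" "\<bar>b\<bar>"] by (simp add: mult.assoc)
    moreover have "\<bar>a * b\<bar> = \<bar>a\<bar> * \<bar>b\<bar>" "0 \<le> \<bar>a\<bar> * \<bar>b\<bar>" by (auto simp: abs_mult)
    ultimately show ?thesis by linarith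
  qed
  then show "AE x in M. norm (f x * g x) \<le> norm ((f x)\<^sup>2 + (g x)\<^sup>2)"
    by simp
qed

lemma L2_add:
  fixes f g :: "'a \<Rightarrow> real"
  assumes "f \<in> L2 M" "g \<in> L2 M"
  shows "(\<lambda>x. f x + g x) \<in> L2 M"
  using assms L2_mult_integrable[OF assms]
  by (auto simp: L2_real power2_sum mult.assoc)

lemma L2_scale:
  fixes f :: "'a \<Rightarrow> real"
  assumes "f \<in> L2 M"
  shows "(\<lambda>x. r * f x) \<in> L2 M"
  using assms by (auto simp: L2_real power_mult_distrib)

lemma L2_lincomb:
  fixes f g :: "'a \<Rightarrow> real"
  assumes "f \<in> L2 M" "g \<in> L2 M"
  shows "(\<lambda>x. r * f x + s * g x) \<in> L2 M"
  using assms by (intro L2_add L2_scale)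

lemma L2_diff:
  fixes f g :: "'a \<Rightarrow> real"
  assumes "f \<in> L2 M" "g \<in> L2 M"
  shows "(\<lambda>x. f x - g x) \<in> L2 M"
  using L2_lincomb[OF assms, of 1 "-1"] by simp

lemma L2_norm_real: "L2_norm M (f :: 'a \<Rightarrow> real) = sqrt (LINT x|M. (f x)\<^sup>2)"
  by (simp add: L2_norm_def)

lemma L2_norm_nonneg: "L2_norm M f \<ge> 0"
  by (simp add: L2_norm_def)

lemma L2_norm_squared: "(L2_norm M (f :: 'a \<Rightarrow> real))\<^sup>2 = (LINT x|M. (f x)\<^sup>2)"
  by (simp add: L2_norm_real)

lemma integral_lincomb_square:
  fixes f g :: "'a \<Rightarrow> real"
  assumes "f \<in> L2 M" "g \<in> L2 M"
  shows "(LINT x|M. (f x + t * g x)\<^sup>2) =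
    (LINT x|M. (f x)\<^sup>2) + 2 * t * (LINT x|M. f x * g x) + t\<^sup>2 * (LINT x|M. (g x)\<^sup>2)"
proof -
  have "(LINT x|M. (f x + t * g x)\<^sup>2) =
      (LINT x|M. (f x)\<^sup>2 + (2 * t) * (f x * g x) + t\<^sup>2 * (g x)\<^sup>2)"
    by (intro Bochner_Integration.integral_cong) (auto simp: power2_eq_square algebra_simps)
  also have "\<dots> = (LINT x|M. (f x)\<^sup>2) + 2 * t * (LINT x|M. f x * g x) + t\<^sup>2 * (LINT x|M. (g x)\<^sup>2)"
    using assms L2_mult_integrable[OF assms] by (simp add: L2_real)
  finally show ?thesis .
qed

lemma nonneg_quadratic:
  fixes a b c :: real
  assumes "\<And>t. a + 2 * t * b + t\<^sup>2 * c \<ge> 0" "c \<ge> 0"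
  shows "b\<^sup>2 \<le> a * c"
proof (cases "c = 0")
  case True
  have "b = 0"
  proof (rule ccontr)
    assume "b \<noteq> 0"
    then show False using assms(1)[of "- (a + 1) / (2 * b)"] True by (simp add: field_simps)
  qed
  then show ?thesis using True by simp
next
  case False
  then have "a - b\<^sup>2 / c \<ge> 0"
    using assms(1)[of "- b / c"] by (simp add: power2_eq_square field_simps)
  then show ?thesis using False assms(2) by (simp add: field_simps)
qed

lemma L2_Cauchy_Schwarz:
  fixes f g :: "'a \<Rightarrow> real"
  assumes "f \<in> L2 M" "g \<in> L2 M"
  shows "\<bar>LINT x|M. f x * g x\<bar> \<le> L2_norm M f * L2_norm M g"
proof -
  have "(LINT x|M. f x * g x)\<^sup>2 \<le> (LINT x|M. (f x)\<^sup>2) * (LINT x|M. (g x)\<^sup>2)"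
  proof (rule nonneg_quadratic)
    fix t
    have "0 \<le> (LINT x|M. (f x + t * g x)\<^sup>2)" by simp
    then show "0 \<le> (LINT x|M. (f x)\<^sup>2) + 2 * t * (LINT x|M. f x * g x) + t\<^sup>2 * (LINT x|M. (g x)\<^sup>2)"
      unfolding integral_lincomb_square[OF assms] .
  qed simp
  then have "(LINT x|M. f x * g x)\<^sup>2 \<le> (L2_norm M f * L2_norm M g)\<^sup>2"
    by (simp add: power_mult_distrib L2_norm_squared)
  then show ?thesis
    using L2_norm_nonneg[of M f] L2_norm_nonneg[of M g] abs_le_square_iff
    by (metis abs_of_nonneg mult_nonneg_nonneg)
qed

text \<open>Completeness, for sequences which are Cauchy at a geometric rate.\<close>

lemma L2_complete:
  fixes u :: "nat \<Rightarrow> 'a \<Rightarrow> real"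
  assumes u: "\<And>n. u n \<in> L2 M"
    and C: "\<And>m n. n \<le> m \<Longrightarrow> (LINT x|M. (u m x - u n x)\<^sup>2) \<le> C * (1/4) ^ n"
  obtains v where "v \<in> L2 M" "\<And>n. (LINT x|M. (v x - u n x)\<^sup>2) \<le> C * (1/4) ^ n"
proof -
  have [measurable]: "u n \<in> borel_measurable M" for n
    using u by (auto simp: L2_real)
  have C0: "C \<ge> 0"
    using C[of 0 0] by simp
  have nnC: "(\<integral>\<^sup>+x. ennreal ((u m x - u n x)\<^sup>2) \<partial>M) \<le> ennreal (C * (1/4) ^ n)" if "n \<le> m" for m n
    using C[OF that] L2_diff[OF u u, of m n]
    by (subst nn_integral_eq_integral) (auto simp: L2_real ennreal_leI)
  have "(\<integral>\<^sup>+x. (\<Sum>n. ennreal (2 ^ n * (u (Suc n) x - u n x)\<^sup>2)) \<partial>M) =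
      (\<Sum>n. \<integral>\<^sup>+x. ennreal (2 ^ n * (u (Suc n) x - u n x)\<^sup>2) \<partial>M)"
    by (rule nn_integral_suminf) auto
  also have "\<dots> \<le> (\<Sum>n. ennreal (C * (1/2) ^ n))"
  proof (rule suminf_le)
    fix n
    have "(\<integral>\<^sup>+x. ennreal (2 ^ n * (u (Suc n) x - u n x)\<^sup>2) \<partial>M) =
        ennreal (2 ^ n) * (\<integral>\<^sup>+x. ennreal ((u (Suc n) x - u n x)\<^sup>2) \<partial>M)"
      by (subst nn_integral_cmult[symmetric]) (auto simp: ennreal_mult)
    also have "\<dots> \<le> ennreal (2 ^ n) * ennreal (C * (1/4) ^ n)"
      by (intro mult_left_mono nnC) auto
    also have "\<dots> = ennreal (2 ^ n * (C * (1/4) ^ n))"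
      using C0 by (subst ennreal_mult) auto
    also have "2 ^ n * (C * (1/4) ^ n) = C * (1/2 :: real) ^ n"
      by (simp add: power_mult_distrib[symmetric] mult.left_commute)
    finally show "(\<integral>\<^sup>+x. ennreal (2 ^ n * (u (Suc n) x - u n x)\<^sup>2) \<partial>M) \<le> ennreal (C * (1/2) ^ n)" .
  qed auto
  also have "\<dots> = ennreal (\<Sum>n. C * (1/2) ^ n)"
    using C0 by (intro suminf_ennreal2 summable_mult summable_geometric) auto
  finally have "(\<integral>\<^sup>+x. (\<Sum>n. ennreal (2 ^ n * (u (Suc n) x - u n x)\<^sup>2)) \<partial>M) \<noteq> \<infinity>"
    by (auto simp: top_unique)
  then have "AE x in M. (\<Sum>n. ennreal (2 ^ n * (u (Suc n) x - u n x)\<^sup>2)) \<noteq> \<infinity>"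
    by (intro nn_integral_noteq_infinite) auto
  then have conv: "AE x in M. (\<lambda>n. u n x) \<longlonglongrightarrow> lim (\<lambda>n. u n x)"
  proof eventually_elim
    case (elim x)
    define d where "d n = u (Suc n) x - u n x" for n
    have "summable (\<lambda>n. 2 ^ n * (d n)\<^sup>2)"
      using elim by (intro summable_suminf_not_top) (auto simp: d_def)
    then have s: "summable (\<lambda>n. (1/2) ^ n + 2 ^ n * (d n)\<^sup>2)"
      by (intro summable_add summable_geometric) auto
    have "summable d"
    proof (rule summable_comparison_test'[OF s])
      fix n
      define r :: real where "r = 2 ^ n"
      have r: "r > 0" by (simp add: r_def)
      have "0 \<le> (1 - r * \<bar>d n\<bar>)\<^sup>2 + r * \<bar>d n\<bar>"
        using r by simp
      then have "r * \<bar>d n\<bar> \<le> 1 + r\<^sup>2 * (d n)\<^sup>2"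
        by (simp add: power2_eq_square algebra_simps)
      then have "r * \<bar>d n\<bar> \<le> r * (1 / r + r * (d n)\<^sup>2)"
        using r by (simp add: power2_eq_square algebra_simps)
      then have "\<bar>d n\<bar> \<le> 1 / r + r * (d n)\<^sup>2"
        using r by simp
      then show "norm (d n) \<le> (1/2) ^ n + 2 ^ n * (d n)\<^sup>2"
        by (simp add: r_def power_one_over)
    qed
    then have "convergent (\<lambda>n. \<Sum>i<n. d i)"
      by (simp add: summable_iff_convergent)
    also have "(\<lambda>n. \<Sum>i<n. d i) = (\<lambda>n. u n x - u 0 x)"
      unfolding d_def by (intro ext sum_lessThan_telescope)
    finally have "convergent (\<lambda>n. (u n x - u 0 x) + u 0 x)"
      by (intro convergent_add convergent_const)
    then show ?case
      by (simp add: convergent_LIMSEQ_iff)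
  qed
  define v where "v x = lim (\<lambda>n. u n x)" for x
  have [measurable]: "v \<in> borel_measurable M"
    unfolding v_def by measurable
  have nnv: "(\<integral>\<^sup>+x. ennreal ((v x - u n x)\<^sup>2) \<partial>M) \<le> ennreal (C * (1/4) ^ n)" for n
  proof -
    have "(\<integral>\<^sup>+x. ennreal ((v x - u n x)\<^sup>2) \<partial>M) =
        (\<integral>\<^sup>+x. liminf (\<lambda>m. ennreal ((u m x - u n x)\<^sup>2)) \<partial>M)"
    proof (rule nn_integral_cong_AE)
      show "AE x in M. ennreal ((v x - u n x)\<^sup>2) = liminf (\<lambda>m. ennreal ((u m x - u n x)\<^sup>2))"
        using conv
      proof eventually_elim
        case (elim x)
        have "(\<lambda>m. ennreal ((u m x - u n x)\<^sup>2)) \<longlonglongrightarrow> ennreal ((v x - u n x)\<^sup>2)"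
          unfolding v_def by (intro tendsto_ennrealI tendsto_intros elim)
        then show ?case
          using lim_imp_Liminf[OF sequentially_bot] by metis
      qed
    qed
    also have "\<dots> \<le> liminf (\<lambda>m. \<integral>\<^sup>+x. ennreal ((u m x - u n x)\<^sup>2) \<partial>M)"
      by (rule nn_integral_liminf) auto
    also have "\<dots> \<le> ennreal (C * (1/4) ^ n)"
      by (rule Liminf_le) (auto intro!: eventually_sequentiallyI[of n] nnC)
    finally show ?thesis .
  qed
  have vu: "(\<lambda>x. v x - u n x) \<in> L2 M" for n
    using nnv[of n] by (auto simp: L2_real integrable_iff_bounded top_unique less_top[symmetric])
  show thesis
  proof
    show "v \<in> L2 M"
      using L2_add[OF vu[of 0] u[of 0]] by simp
    show "(LINT x|M. (v x - u n x)\<^sup>2) \<le> C * (1/4) ^ n" for n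
      using nnv[of n] vu[of n] C0
      by (subst (asm) nn_integral_eq_integral) (auto simp: L2_real)
  qed
qed

lemma L2_Riesz:
  fixes \<phi> :: "('a \<Rightarrow> real) \<Rightarrow> real"
  assumes add: "\<And>f g. f \<in> L2 M \<Longrightarrow> g \<in> L2 M \<Longrightarrow> \<phi> (\<lambda>x. f x + g x) = \<phi> f + \<phi> g"
    and scale: "\<And>r f. f \<in> L2 M \<Longrightarrow> \<phi> (\<lambda>x. r * f x) = r * \<phi> f"
    and bound: "\<And>f. f \<in> L2 M \<Longrightarrow> \<bar>\<phi> f\<bar> \<le> C * L2_norm M f"
  obtains u where "u \<in> L2 M" "\<And>f. f \<in> L2 M \<Longrightarrow> \<phi> f = (LINT x|M. f x * u x)"
proof -
  define F where "F f = (LINT x|M. (f x)\<^sup>2) - 2 * \<phi> f" for f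
  have F_ge: "F f \<ge> - C\<^sup>2" if "f \<in> L2 M" for f
  proof -
    have "F f \<ge> (L2_norm M f)\<^sup>2 - 2 * (C * L2_norm M f)"
      using bound[OF that] unfolding F_def L2_norm_squared by (smt (verit))
    moreover have "(L2_norm M f)\<^sup>2 - 2 * (C * L2_norm M f) + C\<^sup>2 = (L2_norm M f - C)\<^sup>2"
      by (simp add: power2_eq_square algebra_simps)
    ultimately show ?thesis
      using zero_le_power2[of "L2_norm M f - C"] by linarith
  qed
  have zero: "(\<lambda>_. 0 :: real) \<in> L2 M"
    by (simp add: L2_real)
  have bdd: "bdd_below (F ` L2 M)"
    using F_ge by (auto simp: bdd_below_def)
  define I where "I = Inf (F ` L2 M)"
  have I_le: "I \<le> F f" if "f \<in> L2 M" for f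
    unfolding I_def using that bdd by (intro cInf_lower) auto
  have "\<exists>f\<in>L2 M. F f < I + (1/4) ^ n" for n :: nat
  proof -
    have "Inf (F ` L2 M) < I + (1/4) ^ n"
      by (simp add: I_def)
    then show ?thesis
      using bdd zero by (subst (asm) cInf_less_iff) auto
  qed
  then obtain w where w: "\<And>n. w n \<in> L2 M" "\<And>n. F (w n) < I + (1/4) ^ n"
    by metis
  have F_line: "F (\<lambda>x. f x + t * g x) =
      F f + 2 * t * ((LINT x|M. f x * g x) - \<phi> g) + t\<^sup>2 * (LINT x|M. (g x)\<^sup>2)"
    if "f \<in> L2 M" "g \<in> L2 M" for f g t
    unfolding F_def integral_lincomb_square[OF that]
    using that by (simp add: add scale L2_scale algebra_simps)
  have cauchy: "(LINT x|M. (w m x - w n x)\<^sup>2) \<le> 4 * (1/4) ^ n" if "n \<le> m" for m n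
  proof -
    define d where "d x = w m x - w n x" for x
    have d: "d \<in> L2 M"
      unfolding d_def using w by (intro L2_diff)
    have "(\<lambda>x. w n x + 1 * d x) = w m"
      by (auto simp: d_def)
    then have 1: "F (w m) = F (w n) + 2 * ((LINT x|M. w n x * d x) - \<phi> d) + (LINT x|M. (d x)\<^sup>2)"
      using F_line[OF w(1)[of n] d, of 1] by simp
    have "I \<le> F (\<lambda>x. w n x + 1/2 * d x)"
      using d w by (intro I_le L2_add L2_scale)
    then have 2: "I \<le> F (w n) + ((LINT x|M. w n x * d x) - \<phi> d) + (LINT x|M. (d x)\<^sup>2) / 4"
      using F_line[OF w(1)[of n] d, of "1/2"] by (simp add: power2_eq_square)
    have "(1/4 :: real) ^ m \<le> (1/4) ^ n"
      using that by (intro power_decreasing) auto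
    then have "(LINT x|M. (d x)\<^sup>2) \<le> 4 * (1/4) ^ n"
      using 1 2 w(2)[of m] w(2)[of n] by argo
    then show ?thesis
      by (simp add: d_def)
  qed
  from L2_complete[of w M 4, OF w(1) cauchy]
  obtain u where u: "u \<in> L2 M" "\<And>n. (LINT x|M. (u x - w n x)\<^sup>2) \<le> 4 * (1/4) ^ n"
    by metis
  have F_u: "F u \<le> I"
  proof -
    define D where "D = 2 * (\<bar>C\<bar> + L2_norm M u) * 2"
    have est: "F u \<le> I + (1/4) ^ n + D * (1/2) ^ n" for n
    proof -
      define d where "d x = w n x - u x" for x
      have d: "d \<in> L2 M"
        unfolding d_def using w u by (intro L2_diff)
      have "(LINT x|M. (d x)\<^sup>2) \<le> 4 * (1/4) ^ n"
        using u(2)[of n] by (simp add: d_def power2_commute)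
      also have "4 * (1/4 :: real) ^ n = (2 * (1/2) ^ n)\<^sup>2"
        by (simp add: power_mult_distrib power2_eq_square power_mult_distrib[symmetric])
      finally have nd: "L2_norm M d \<le> 2 * (1/2) ^ n"
        unfolding L2_norm_real by (intro real_le_lsqrt) auto
      have "(\<lambda>x. u x + 1 * d x) = w n"
        by (auto simp: d_def)
      then have "F (w n) = F u + 2 * ((LINT x|M. u x * d x) - \<phi> d) + (LINT x|M. (d x)\<^sup>2)"
        using F_line[OF u(1) d, of 1] by simp
      then have "F u \<le> F (w n) + 2 * (\<bar>LINT x|M. u x * d x\<bar> + \<bar>\<phi> d\<bar>)"
        using Bochner_Integration.integral_nonneg[where M = M and f = "\<lambda>x. (d x)\<^sup>2"]
        by (smt (verit) zero_le_power2)
      also have "\<dots> \<le> F (w n) + 2 * (L2_norm M u * L2_norm M d + \<bar>C\<bar> * L2_norm M d)"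
      proof -
        have "\<bar>\<phi> d\<bar> \<le> \<bar>C\<bar> * L2_norm M d"
          using bound[OF d] L2_norm_nonneg[of M d]
          by (meson abs_ge_self mult_right_mono order_trans)
        then show ?thesis
          using L2_Cauchy_Schwarz[OF u(1) d] by (intro add_left_mono mult_left_mono add_mono) auto
      qed
      also have "\<dots> = F (w n) + 2 * (\<bar>C\<bar> + L2_norm M u) * L2_norm M d"
        by (simp add: algebra_simps)
      also have "\<dots> \<le> F (w n) + 2 * (\<bar>C\<bar> + L2_norm M u) * (2 * (1/2) ^ n)"
        using nd L2_norm_nonneg[of M u] by (intro add_left_mono mult_left_mono) auto
      also have "\<dots> \<le> I + (1/4) ^ n + D * (1/2) ^ n"
        using w(2)[of n] by (simp only: D_def mult.assoc)
      finally show ?thesis .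
    qed
    have "(\<lambda>n. I + (1/4) ^ n + D * (1/2) ^ n) \<longlonglongrightarrow> I + 0 + D * 0"
      by (intro tendsto_intros LIMSEQ_power_zero) auto
    then show ?thesis
      using est by (intro LIMSEQ_le_const[where X = "\<lambda>n. I + (1/4) ^ n + D * (1/2) ^ n"]) auto
  qed
  have "\<phi> f = (LINT x|M. f x * u x)" if f: "f \<in> L2 M" for f
  proof -
    define b where "b = (LINT x|M. u x * f x) - \<phi> f"
    have "b\<^sup>2 \<le> 0 * (LINT x|M. (f x)\<^sup>2)"
    proof (rule nonneg_quadratic)
      fix t
      have "F u \<le> F (\<lambda>x. u x + t * f x)"
        using F_u I_le[OF L2_add[OF u(1) L2_scale[OF f]]] by (rule order_trans)
      then show "0 \<le> 0 + 2 * t * b + t\<^sup>2 * (LINT x|M. (f x)\<^sup>2)"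
        unfolding F_line[OF u(1) f] b_def by simp
    qed simp
    then show ?thesis
      by (simp add: b_def mult.commute)
  qed
  then show thesis
    using u(1) that by blast
qed

lemma L2_eq_AE_I:
  fixes u v :: "'a \<Rightarrow> real"
  assumes "u \<in> L2 M" "v \<in> L2 M"
    and "\<And>f. f \<in> L2 M \<Longrightarrow> (LINT x|M. f x * u x) = (LINT x|M. f x * v x)"
  shows "AE x in M. u x = v x"
proof -
  define d where "d x = u x - v x" for x
  have d: "d \<in> L2 M"
    unfolding d_def using assms by (intro L2_diff)
  have "(LINT x|M. (d x)\<^sup>2) = (LINT x|M. d x * u x - d x * v x)"
    by (intro Bochner_Integration.integral_cong) (auto simp: d_def power2_eq_square algebra_simps)
  also have "\<dots> = 0"
    using assms d by (simp add: L2_mult_integrable)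
  finally have "AE x in M. (d x)\<^sup>2 = 0"
    using d by (subst (asm) integral_nonneg_eq_0_iff_AE) (auto simp: L2_real)
  then show ?thesis
    by (auto simp: d_def)
qed

lemma L2_adjoint:
  assumes "L2_operator M K"
  shows "L2_is_adjoint M K (L2_adjoint M K)"
proof -
  have K: "K f \<in> L2 M" if "f \<in> L2 M" for f
    using assms that by (auto simp: L2_operator_def)
  have Kadd: "AE x in M. K (\<lambda>y. f y + g y) x = K f x + K g x" if "f \<in> L2 M" "g \<in> L2 M" for f g
    using assms that by (auto simp: L2_operator_def)
  have Kscale: "AE x in M. K (\<lambda>y. r * f y) x = r * K f x" if "f \<in> L2 M" for f r
    using assms that by (auto simp: L2_operator_def)
  obtain C where C: "\<And>f. f \<in> L2 M \<Longrightarrow> L2_norm M (K f) \<le> C * L2_norm M f"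
    using assms unfolding L2_operator_def by blast
  have m: "f \<in> borel_measurable M" if "f \<in> L2 M" for f :: "'a \<Rightarrow> real"
    using that by (simp add: L2_real)
  have "\<exists>u. u \<in> L2 M \<and> (\<forall>f\<in>L2 M. (LINT x|M. K f x * g x) = (LINT x|M. f x * u x))"
    if g: "g \<in> L2 M" for g
  proof -
    have "(LINT x|M. K (\<lambda>y. f y + h y) x * g x) = (LINT x|M. K f x * g x) + (LINT x|M. K h x * g x)"
      if "f \<in> L2 M" "h \<in> L2 M" for f h
    proof -
      have [measurable]: "f \<in> borel_measurable M" "h \<in> borel_measurable M" "g \<in> borel_measurable M"
        "K f \<in> borel_measurable M" "K h \<in> borel_measurable M"
        "K (\<lambda>y. f y + h y) \<in> borel_measurable M"
        using that g by (simp_all add: m K L2_add)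
      have "(LINT x|M. K (\<lambda>y. f y + h y) x * g x) = (LINT x|M. K f x * g x + K h x * g x)"
      proof (rule integral_cong_AE)
        show "AE x in M. K (\<lambda>y. f y + h y) x * g x = K f x * g x + K h x * g x"
          using Kadd[OF that] by eventually_elim (simp add: algebra_simps)
      qed measurable
      then show ?thesis
        using that g by (simp add: L2_mult_integrable K)
    qed
    moreover have "(LINT x|M. K (\<lambda>y. r * f y) x * g x) = r * (LINT x|M. K f x * g x)"
      if "f \<in> L2 M" for f r
    proof -
      have [measurable]: "f \<in> borel_measurable M" "g \<in> borel_measurable M"
        "K f \<in> borel_measurable M" "K (\<lambda>y. r * f y) \<in> borel_measurable M"
        using that g by (simp_all add: m K L2_scale)
      have "(LINT x|M. K (\<lambda>y. r * f y) x * g x) = (LINT x|M. r * (K f x * g x))"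
      proof (rule integral_cong_AE)
        show "AE x in M. K (\<lambda>y. r * f y) x * g x = r * (K f x * g x)"
          using Kscale[OF that, of r] by eventually_elim simp
      qed measurable
      then show ?thesis by simp
    qed
    moreover have "\<bar>LINT x|M. K f x * g x\<bar> \<le> (C * L2_norm M g) * L2_norm M f" if "f \<in> L2 M" for f
    proof -
      have "\<bar>LINT x|M. K f x * g x\<bar> \<le> L2_norm M (K f) * L2_norm M g"
        using that g by (intro L2_Cauchy_Schwarz K)
      also have "\<dots> \<le> (C * L2_norm M f) * L2_norm M g"
        by (intro mult_right_mono C that L2_norm_nonneg)
      finally show ?thesis by (simp add: mult_ac)
    qed
    ultimately show ?thesis
      by (rule L2_Riesz[where \<phi> = "\<lambda>f. LINT x|M. K f x * g x"]) auto
  qed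
  then obtain K' where K': "\<And>g. g \<in> L2 M \<Longrightarrow> K' g \<in> L2 M"
    and adj: "\<And>f g. f \<in> L2 M \<Longrightarrow> g \<in> L2 M \<Longrightarrow> (LINT x|M. K f x * g x) = (LINT x|M. f x * K' g x)"
    by metis
  have adj': "(LINT x|M. f x * K' g x) = (LINT x|M. K f x * g x)" if "f \<in> L2 M" "g \<in> L2 M" for f g
    using adj[OF that] by simp
  have "L2_operator M K'"
    unfolding L2_operator_def
  proof (intro conjI ballI impI allI)
    fix f g :: "'a \<Rightarrow> real"
    assume f: "f \<in> L2 M" and g: "g \<in> L2 M"
    show "AE x in M. K' f x = K' g x" if "AE x in M. f x = g x"
    proof (intro L2_eq_AE_I K' f g)
      fix k :: "'a \<Rightarrow> real"
      assume k: "k \<in> L2 M"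
      have [measurable]: "f \<in> borel_measurable M" "g \<in> borel_measurable M" "K k \<in> borel_measurable M"
        using f g k by (simp_all add: m K)
      have "(LINT x|M. K k x * f x) = (LINT x|M. K k x * g x)"
      proof (rule integral_cong_AE)
        show "AE x in M. K k x * f x = K k x * g x"
          using that by eventually_elim simp
      qed measurable
      then show "(LINT x|M. k x * K' f x) = (LINT x|M. k x * K' g x)"
        using f g k by (simp add: adj')
    qed
    show "AE x in M. K' (\<lambda>y. f y + g y) x = K' f x + K' g x"
      using f g
      by (intro L2_eq_AE_I K' L2_add) (auto simp: adj' L2_add distrib_left L2_mult_integrable K K')
  next
    fix r :: real and f :: "'a \<Rightarrow> real"
    assume f: "f \<in> L2 M"
    show "AE x in M. K' (\<lambda>y. r * f y) x = r * K' f x"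
      using f by (intro L2_eq_AE_I K' L2_scale) (auto simp: adj' L2_scale mult.left_commute)
  next
    have "L2_norm M (K' g) \<le> \<bar>C\<bar> * L2_norm M g" if g: "g \<in> L2 M" for g
    proof (cases "L2_norm M (K' g) = 0")
      case True
      then show ?thesis by (simp add: L2_norm_nonneg)
    next
      case False
      have "L2_norm M (K' g) * L2_norm M (K' g) = (LINT x|M. K (K' g) x * g x)"
        using adj[OF K'[OF g] g] L2_norm_squared[of M "K' g"] by (simp add: power2_eq_square)
      also have "\<dots> \<le> L2_norm M (K (K' g)) * L2_norm M g"
        using L2_Cauchy_Schwarz[OF K[OF K'[OF g]] g] by simp
      also have "\<dots> \<le> (C * L2_norm M (K' g)) * L2_norm M g"
        by (intro mult_right_mono C K' g L2_norm_nonneg)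
      also have "\<dots> \<le> (\<bar>C\<bar> * L2_norm M (K' g)) * L2_norm M g"
        by (intro mult_right_mono L2_norm_nonneg) auto
      finally have "L2_norm M (K' g) * L2_norm M (K' g) \<le> L2_norm M (K' g) * (\<bar>C\<bar> * L2_norm M g)"
        by (simp add: mult_ac)
      then show ?thesis
        using False L2_norm_nonneg[of M "K' g"] by (simp add: mult_le_cancel_left)
    qed
    then show "\<exists>D. \<forall>g\<in>L2 M. L2_norm M (K' g) \<le> D * L2_norm M g"
      by blast
  qed (use K' in auto)
  then have "L2_is_adjoint M K K'"
    using adj by (auto simp: L2_is_adjoint_def)
  then show ?thesis
    unfolding L2_adjoint_def by (rule someI[of "L2_is_adjoint M K"])
qed


section \<open>Signs and the measures attached to sign sequences\<close>

datatype sign = Plus | Minus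

definition pair_partitions :: "nat \<Rightarrow> (nat \<Rightarrow> sign) \<Rightarrow> nat set set set" where
  "pair_partitions k sg = {\<theta>. partition_on {1..k} \<theta> \<and> (\<forall>B\<in>\<theta>. card B \<le> 2) \<and>
     (\<forall>a b. a \<noteq> b \<and> {a, b} \<in> \<theta> \<longrightarrow> sg a \<noteq> sg b)}"

text \<open>The variables of the product measure are indexed by the blocks themselves instead of by
  their rank with respect to the minima.\<close>

definition partition_measure :: "'y measure \<Rightarrow> nat \<Rightarrow> nat set set \<Rightarrow> (nat \<Rightarrow> 'y) measure" where
  "partition_measure \<mu> k \<theta> =
     distr (PiM \<theta> (\<lambda>_. \<mu>)) (PiM {1..k} (\<lambda>_. \<mu>))
       (\<lambda>y. \<lambda>i\<in>{1..k}. y (THE B. B \<in> \<theta> \<and> i \<in> B))"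

definition sign_measure :: "'y measure \<Rightarrow> nat \<Rightarrow> (nat \<Rightarrow> sign) \<Rightarrow> (nat \<Rightarrow> 'y) measure" where
  "sign_measure \<mu> k sg =
     measure_of (space (PiM {1..k} (\<lambda>_. \<mu>))) (sets (PiM {1..k} (\<lambda>_. \<mu>)))
       (\<lambda>A. \<Sum>\<theta>\<in>pair_partitions k sg. emeasure (partition_measure \<mu> k \<theta>) A)"


section \<open>The Fock space of R-symmetric functions\<close>

text \<open>Functions of $n$ variables are functions on the space of \<open>PiM {1..n} (\<lambda>_. M)\<close>.\<close>

definition perm_factor ::
    "('y \<Rightarrow> 'y \<Rightarrow> complex) \<Rightarrow> nat \<Rightarrow> (nat \<Rightarrow> nat) \<Rightarrow> (nat \<Rightarrow> 'y) \<Rightarrow> complex" where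
  "perm_factor R n \<pi> x =
     (\<Prod>(i, j) \<in> {(i, j). 1 \<le> i \<and> i < j \<and> j \<le> n \<and> \<pi> i > \<pi> j}. R (x i) (x j))"

definition fock_proj ::
    "('y \<Rightarrow> 'y \<Rightarrow> complex) \<Rightarrow> nat \<Rightarrow> ((nat \<Rightarrow> 'y) \<Rightarrow> complex) \<Rightarrow> ((nat \<Rightarrow> 'y) \<Rightarrow> complex)" where
  "fock_proj R n f =
     (\<lambda>x. (\<Sum>\<pi> | \<pi> permutes {1..n}. perm_factor R n \<pi> x * f (\<lambda>i. x (inv \<pi> i))) / fact n)"

definition sym_functions ::
    "'y measure \<Rightarrow> ('y \<Rightarrow> 'y \<Rightarrow> complex) \<Rightarrow> nat \<Rightarrow> ((nat \<Rightarrow> 'y) \<Rightarrow> complex) set" where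
  "sym_functions M R n = {f \<in> L2 (PiM {1..n} (\<lambda>_. M)).
     \<forall>i\<in>{1..<n}. AE x in PiM {1..n} (\<lambda>_. M).
       f x = R (x i) (x (i + 1)) * f (x(i := x (i + 1), i + 1 := x i))}"

type_synonym 'y fock_vector = "nat \<Rightarrow> (nat \<Rightarrow> 'y) \<Rightarrow> complex"

definition fock :: "'y measure \<Rightarrow> ('y \<Rightarrow> 'y \<Rightarrow> complex) \<Rightarrow> 'y fock_vector set" where
  "fock M R = {f. (\<forall>n. f n \<in> sym_functions M R n) \<and>
     summable (\<lambda>n. fact n * (L2_norm (PiM {1..n} (\<lambda>_. M)) (f n))\<^sup>2)}"

definition fock_fin :: "'y measure \<Rightarrow> ('y \<Rightarrow> 'y \<Rightarrow> complex) \<Rightarrow> 'y fock_vector set" where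
  "fock_fin M R = {f \<in> fock M R. \<exists>N. \<forall>n>N. AE x in PiM {1..n} (\<lambda>_. M). f n x = 0}"

definition fock_inner :: "'y measure \<Rightarrow> 'y fock_vector \<Rightarrow> 'y fock_vector \<Rightarrow> complex" where
  "fock_inner M f g = (\<Sum>n. fact n * (LINT x|PiM {1..n} (\<lambda>_. M). f n x * cnj (g n x)))"

definition fock_vacuum :: "'y fock_vector" where
  "fock_vacuum = (\<lambda>n x. if n = 0 then 1 else 0)"


section \<open>Operator-valued integrals\<close>

text \<open>
  The letter \<open>Init i\<close> is the variable $t_i$ of the initial word, and \<open>Created j\<close> is the letter put
  in front of the word at step $j$. For a history \<open>c\<close>, \<open>yvar c j\<close> is the letter with which
  $y_j$ is identified, and an entry \<open>(z, u)\<close> of \<open>factors c\<close> stands for the factor $R(z,u)$.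
\<close>

datatype letter = Init nat | Created nat

datatype history =
  History (word: "letter list") (yvar: "nat \<Rightarrow> letter")
    (factors: "(letter \<times> letter) list") (deleted: "letter set")

fun history_step :: "sign \<Rightarrow> nat \<Rightarrow> history \<Rightarrow> history list" where
  "history_step Plus j (History w a p D) =
     [History (Created j # w) (a(j := Created j)) p D]"
| "history_step Minus j (History w a p D) =
     map (\<lambda>l. History (take l w @ drop (Suc l) w) (a(j := w ! l))
            (p @ map (\<lambda>u. (w ! l, u)) (take l w)) (insert (w ! l) D))
       [0..<length w]"

text \<open>\<open>histories sg k n r\<close> lists the outcomes of the steps $j = k, k-1, \dots, k-r+1$, one entry for
  each sequence of choices; complete histories are obtained for $r = k$.\<close>

primrec histories :: "(nat \<Rightarrow> sign) \<Rightarrow> nat \<Rightarrow> nat \<Rightarrow> nat \<Rightarrow> history list" where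
  "histories sg k n 0 = [History (map Init [1..<Suc n]) (\<lambda>_. undefined) [] {}]"
| "histories sg k n (Suc r) =
     concat (map (history_step (sg (k - r)) (k - r)) (histories sg k n r))"

text \<open>In the evaluation \<open>e\<close> below, the letters of the final word take the values $x_1, x_2, \dots$ in
  order, and the deleted letters are integration variables.\<close>

definition history_integral ::
    "'y measure \<Rightarrow> ('y \<Rightarrow> 'y \<Rightarrow> complex) \<Rightarrow> nat \<Rightarrow> (nat \<Rightarrow> 'y \<Rightarrow> complex) \<Rightarrow>
     ((nat \<Rightarrow> 'y) \<Rightarrow> complex) \<Rightarrow> nat \<Rightarrow> history \<Rightarrow> ((nat \<Rightarrow> 'y) \<Rightarrow> complex) \<Rightarrow> (nat \<Rightarrow> 'y) \<Rightarrow> complex" where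
  "history_integral M R k g \<kappa> n c f x =
     (LINT \<omega>|PiM (deleted c) (\<lambda>_. M).
        (let e = (\<lambda>z. case map_of (zip (word c) (map x [1..<Suc (length (word c))])) z of
                        Some y \<Rightarrow> y | None \<Rightarrow> \<omega> z);
             y = (\<lambda>j\<in>{1..k}. e (yvar c j))
         in (\<Prod>j=1..k. g j (y j)) * \<kappa> y * f (\<lambda>i\<in>{1..n}. e (Init i))
            * prod_list (map (\<lambda>(z, u). R (e z) (e u)) (factors c))))"

text \<open>The component in degree $n'$ collects the histories whose final word has length $n'$;
  these start from a word of length $n \le n' + k$.\<close>

definition operator_integral ::
    "'y measure \<Rightarrow> ('y \<Rightarrow> 'y \<Rightarrow> complex) \<Rightarrow> nat \<Rightarrow> (nat \<Rightarrow> sign) \<Rightarrow> (nat \<Rightarrow> 'y \<Rightarrow> complex) \<Rightarrow>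
     ((nat \<Rightarrow> 'y) \<Rightarrow> complex) \<Rightarrow> 'y fock_vector \<Rightarrow> 'y fock_vector" where
  "operator_integral M R k sg g \<kappa> =
     (\<lambda>f\<in>fock_fin M R. \<lambda>n'. fock_proj R n' (\<lambda>x.
        \<Sum>n\<le>n' + k. \<Sum>c\<leftarrow>filter (\<lambda>c. length (word c) = n') (histories sg k n k).
          history_integral M R k g \<kappa> n c (f n) x))"


section \<open>The doubled space and the vacuum state\<close>

text \<open>The coordinate $x^1$ of $x\in\mathbb R^d$ is \<open>x $ c\<close>, where the index \<open>c :: 'd\<close> plays the role of $1$.\<close>

definition exchange_function ::
    "'d::finite \<Rightarrow> real \<Rightarrow> (real^'d \<Rightarrow> real^'d \<Rightarrow> complex) \<Rightarrow> bool" where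
  "exchange_function c \<eta> Q \<longleftrightarrow>
     (\<lambda>(x, y). Q x y) \<in> borel_measurable borel \<and>
     (\<forall>x y x' y'. x $ c = x' $ c \<and> y $ c = y' $ c \<longrightarrow> Q x y = Q x' y') \<and>
     (\<forall>x y. x $ c \<noteq> y $ c \<longrightarrow> norm (Q x y) = 1 \<and> Q x y = cnj (Q y x)) \<and>
     (\<forall>x y. x $ c = y $ c \<longrightarrow> Q x y = complex_of_real \<eta>)"

definition commutes_with_multiplications ::
    "'d::finite \<Rightarrow> ((real^'d \<Rightarrow> real) \<Rightarrow> (real^'d \<Rightarrow> real)) \<Rightarrow> bool" where
  "commutes_with_multiplications c K \<longleftrightarrow>
     (\<forall>\<psi>\<in>borel_measurable borel. bounded (range \<psi>) \<longrightarrow>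
        (\<forall>f\<in>L2 lborel. AE x in lborel. K (\<lambda>y. \<psi> (y $ c) * f y) x = \<psi> (x $ c) * K f x))"

text \<open>\<open>(i, x)\<close> is the point of the copy $X_i$ corresponding to \<open>x\<close>.\<close>

type_synonym 'd doubled = "nat \<times> (real^'d)"

definition Zm :: "'d::finite doubled measure" where
  "Zm = count_space {1, 2} \<Otimes>\<^sub>M lborel"

definition JQ :: "(real^'d \<Rightarrow> real^'d \<Rightarrow> complex) \<Rightarrow> 'd doubled \<Rightarrow> 'd doubled \<Rightarrow> complex" where
  "JQ Q p q = (if fst p = fst q then Q (snd p) (snd q) else Q (snd q) (snd p))"

fun copy_sign :: "nat \<Rightarrow> sign \<Rightarrow> sign" where
  "copy_sign i Plus = (if i = 1 then Minus else Plus)"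
| "copy_sign i Minus = (if i = 1 then Plus else Minus)"

definition copy_embed ::
    "((real^'d \<Rightarrow> real) \<Rightarrow> (real^'d \<Rightarrow> real)) \<Rightarrow> ((real^'d \<Rightarrow> real) \<Rightarrow> (real^'d \<Rightarrow> real)) \<Rightarrow>
     nat \<Rightarrow> (real^'d \<Rightarrow> complex) \<Rightarrow> 'd doubled \<Rightarrow> complex" where
  "copy_embed K1 K2 i h p =
     (if fst p = i then complexify (if i = 1 then K1 else K2) h (snd p) else 0)"

definition copy_lift ::
    "'d::finite \<Rightarrow> nat \<Rightarrow> (nat \<Rightarrow> nat) \<Rightarrow> ((nat \<Rightarrow> real) \<Rightarrow> complex) \<Rightarrow> (nat \<Rightarrow> 'd doubled) \<Rightarrow> complex" where
  "copy_lift c k i v z =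
     (if \<forall>j\<in>{1..k}. fst (z j) = i j then v (\<lambda>j\<in>{1..k}. snd (z j) $ c) else 0)"

definition gen_operator ::
    "'d::finite \<Rightarrow> (real^'d \<Rightarrow> real^'d \<Rightarrow> complex) \<Rightarrow>
     ((real^'d \<Rightarrow> real) \<Rightarrow> (real^'d \<Rightarrow> real)) \<Rightarrow> ((real^'d \<Rightarrow> real) \<Rightarrow> (real^'d \<Rightarrow> real)) \<Rightarrow>
     nat \<Rightarrow> (nat \<Rightarrow> sign) \<Rightarrow> (nat \<Rightarrow> real^'d \<Rightarrow> complex) \<Rightarrow> ((nat \<Rightarrow> real) \<Rightarrow> complex) \<Rightarrow>
     'd doubled fock_vector \<Rightarrow> 'd doubled fock_vector" where
  "gen_operator c Q K1 K2 k sg h v =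
     (\<lambda>f\<in>fock_fin Zm (JQ Q). \<lambda>n x. \<Sum>i\<in>{1..k} \<rightarrow>\<^sub>E {1, 2}.
        operator_integral Zm (JQ Q) k (\<lambda>j. copy_sign (i j) (sg j))
          (\<lambda>j. copy_embed K1 K2 (i j) (h j)) (copy_lift c k i v) f n x)"

text \<open>The algebra generated by the operators above; for \<open>k = 0\<close> these are the multiples of the
  identity.\<close>

inductive_set gen_algebra ::
    "'d::finite \<Rightarrow> (real^'d \<Rightarrow> real^'d \<Rightarrow> complex) \<Rightarrow>
     ((real^'d \<Rightarrow> real) \<Rightarrow> (real^'d \<Rightarrow> real)) \<Rightarrow> ((real^'d \<Rightarrow> real) \<Rightarrow> (real^'d \<Rightarrow> real)) \<Rightarrow>
     ('d doubled fock_vector \<Rightarrow> 'd doubled fock_vector) set"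
  for c Q K1 K2 where
  gen: "\<lbrakk>\<forall>j\<in>{1..k}. h j \<in> L2 lborel; v \<in> Linfty (sign_measure lborel k sg)\<rbrakk> \<Longrightarrow>
     gen_operator c Q K1 K2 k sg h v \<in> gen_algebra c Q K1 K2"
| add: "\<lbrakk>a \<in> gen_algebra c Q K1 K2; b \<in> gen_algebra c Q K1 K2\<rbrakk> \<Longrightarrow>
     (\<lambda>f\<in>fock_fin Zm (JQ Q). \<lambda>n x. a f n x + b f n x) \<in> gen_algebra c Q K1 K2"
| scale: "a \<in> gen_algebra c Q K1 K2 \<Longrightarrow>
     (\<lambda>f\<in>fock_fin Zm (JQ Q). \<lambda>n x. r * a f n x) \<in> gen_algebra c Q K1 K2"
| mult: "\<lbrakk>a \<in> gen_algebra c Q K1 K2; b \<in> gen_algebra c Q K1 K2\<rbrakk> \<Longrightarrow>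
     (\<lambda>f\<in>fock_fin Zm (JQ Q). a (b f)) \<in> gen_algebra c Q K1 K2"

definition vacuum_state ::
    "'d::finite \<Rightarrow> (real^'d \<Rightarrow> real^'d \<Rightarrow> complex) \<Rightarrow>
     ((real^'d \<Rightarrow> real) \<Rightarrow> (real^'d \<Rightarrow> real)) \<Rightarrow> ((real^'d \<Rightarrow> real) \<Rightarrow> (real^'d \<Rightarrow> real)) \<Rightarrow>
     ('d doubled fock_vector \<Rightarrow> 'd doubled fock_vector) \<Rightarrow> complex" where
  "vacuum_state c Q K1 K2 =
     (\<lambda>a\<in>gen_algebra c Q K1 K2. fock_inner Zm (a fock_vacuum) fock_vacuum)"

definition n_point ::
    "'d::finite \<Rightarrow> (real^'d \<Rightarrow> real^'d \<Rightarrow> complex) \<Rightarrow>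
     ((real^'d \<Rightarrow> real) \<Rightarrow> (real^'d \<Rightarrow> real)) \<Rightarrow> ((real^'d \<Rightarrow> real) \<Rightarrow> (real^'d \<Rightarrow> real)) \<Rightarrow>
     nat \<Rightarrow> (nat \<Rightarrow> real^'d \<Rightarrow> complex) \<Rightarrow> ((nat \<Rightarrow> real) \<Rightarrow> complex) \<Rightarrow> complex" where
  "n_point c Q K1 K2 n h v =
     vacuum_state c Q K1 K2
       (gen_operator c Q K1 K2 (2 * n) (\<lambda>j. if j \<le> n then Plus else Minus) h v)"

end

theory Submission
  imports Defs
begin

text \<open>
  Each history turning the vacuum into a multiple of itself pairs creation steps with deletion
  steps. A history which survives the integration only pairs letters of the same copy, which forces
  all of them to lie in the first copy: there all steps \<open>n + 1, \<dots>, 2n\<close> create and all steps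
  \<open>1, \<dots>, n\<close> delete, so that the surviving histories correspond to the permutations \<open>\<pi>\<close>, and the
  recorded factors multiply to \<open>Q\<^sub>\<pi>\<close>. It remains to replace \<open>K\<^sub>1 g\<^sub>i \<cdot> K\<^sub>1 h\<^bsub>\<pi> i\<^esub>\<close> by
  \<open>g\<^sub>i \<cdot> T h\<^bsub>\<pi> i\<^esub>\<close> in the integrals. As \<open>K\<^sub>1\<close> commutes with multiplication by functions of
  \<open>x\<^sup>1\<close>, both products have the same integral against each bounded function of \<open>x\<^sup>1\<close>. Since
  \<open>Q\<^sub>\<pi>\<close> only depends on the first coordinates, Fubini's theorem allows the replacement one
  variable at a time.
\<close>

section \<open>Transfer of integrals over product measures\<close>

lemma measurable_PiM_reindex:
  assumes "s \<in> M \<rightarrow>\<^sub>M S"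
  shows "(\<lambda>x. \<lambda>i\<in>I. s (x (\<phi> i))) \<in> PiM (\<phi> ` I) (\<lambda>_. M) \<rightarrow>\<^sub>M PiM I (\<lambda>_. S)"
  by (rule measurable_restrict, rule measurable_compose[OF _ assms], rule measurable_component_singleton) auto

text \<open>As \<open>\<phi>\<close> is injective, the arguments \<open>x (\<phi> i)\<close> are
  different coordinates, so the product of the integrable functions is integrable; the bounded
  factor only costs the constant \<open>B\<close>.\<close>

lemma integrable_PiM_prod_bounded:
  fixes a :: "'i \<Rightarrow> 'a \<Rightarrow> complex" and q :: "('i \<Rightarrow> 's) \<Rightarrow> complex"
  assumes "sigma_finite_measure M" and I: "finite I" "inj_on \<phi> I"
    and s: "s \<in> M \<rightarrow>\<^sub>M S"
    and a: "\<And>i. i \<in> I \<Longrightarrow> integrable M (a i)"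
    and q: "q \<in> borel_measurable (PiM I (\<lambda>_. S))" "\<And>z. norm (q z) \<le> B"
  shows "integrable (PiM (\<phi> ` I) (\<lambda>_. M))
    (\<lambda>x. (\<Prod>i\<in>I. a i (x (\<phi> i))) * q (\<lambda>i\<in>I. s (x (\<phi> i))))"
proof -
  interpret product_sigma_finite "\<lambda>_. M"
    using assms by (simp add: product_sigma_finite_def)
  have "integrable (PiM (\<phi> ` I) (\<lambda>_. M)) (\<lambda>x. \<Prod>j\<in>\<phi> ` I. a (inv_into I \<phi> j) (x j))"
    using I a by (intro product_integrable_prod) auto
  then have 1: "integrable (PiM (\<phi> ` I) (\<lambda>_. M)) (\<lambda>x. \<Prod>i\<in>I. a i (x (\<phi> i)))"
    using I by (simp add: prod.reindex)
  show ?thesis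
  proof (rule Bochner_Integration.integrable_bound)
    show "integrable (PiM (\<phi> ` I) (\<lambda>_. M)) (\<lambda>x. complex_of_real B * (\<Prod>i\<in>I. a i (x (\<phi> i))))"
      using 1 by simp
    show "(\<lambda>x. (\<Prod>i\<in>I. a i (x (\<phi> i))) * q (\<lambda>i\<in>I. s (x (\<phi> i)))) \<in> borel_measurable (PiM (\<phi> ` I) (\<lambda>_. M))"
      by (intro borel_measurable_times borel_measurable_integrable[OF 1]
          measurable_compose[OF measurable_PiM_reindex[OF s] q(1)])
    have "norm (p * q z) \<le> norm (complex_of_real B * p)" for p z
      using mult_right_mono[OF order_trans[OF q(2) abs_ge_self], of "norm p" z]
      by (simp add: norm_mult mult.commute)
    then show "AE x in PiM (\<phi> ` I) (\<lambda>_. M). norm ((\<Prod>i\<in>I. a i (x (\<phi> i))) * q (\<lambda>i\<in>I. s (x (\<phi> i))))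
        \<le> norm (complex_of_real B * (\<Prod>i\<in>I. a i (x (\<phi> i))))"
      by blast
  qed
qed

text \<open>The hypothesis says that \<open>a i\<close> and \<open>b i\<close>, read as densities,
  have the same image under \<open>s\<close> and \<open>t\<close>. The variables are exchanged one
  at a time by Fubini's theorem. The bounded function \<open>q\<close> stays arbitrary in the
  induction, because integrating out one variable produces another such function. The coordinates on
  the left are indexed through \<open>\<phi>\<close>, since they will be letters.\<close>

lemma integral_PiM_transfer:
  fixes a :: "'i \<Rightarrow> 'a \<Rightarrow> complex" and b :: "'i \<Rightarrow> 'b \<Rightarrow> complex" and q :: "('i \<Rightarrow> 's) \<Rightarrow> complex"
  assumes M: "sigma_finite_measure M" and N: "sigma_finite_measure N"
    and s: "s \<in> M \<rightarrow>\<^sub>M S" and t: "t \<in> N \<rightarrow>\<^sub>M S"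
    and "finite I" "inj_on \<phi> I"
    and "\<And>i. i \<in> I \<Longrightarrow> integrable M (a i)" and "\<And>i. i \<in> I \<Longrightarrow> integrable N (b i)"
    and "\<And>i \<psi>. \<lbrakk>i \<in> I; \<psi> \<in> borel_measurable S; bounded (range \<psi>)\<rbrakk> \<Longrightarrow>
           (LINT x|M. a i x * \<psi> (s x)) = (LINT x|N. b i x * \<psi> (t x))"
    and "q \<in> borel_measurable (PiM I (\<lambda>_. S))" "\<And>z. norm (q z) \<le> B"
  shows "(LINT x|PiM (\<phi> ` I) (\<lambda>_. M). (\<Prod>i\<in>I. a i (x (\<phi> i))) * q (\<lambda>i\<in>I. s (x (\<phi> i)))) =
    (LINT x|PiM I (\<lambda>_. N). (\<Prod>i\<in>I. b i (x i)) * q (\<lambda>i\<in>I. t (x i)))"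
  using assms(5-)
proof (induction I arbitrary: q B rule: finite_induct)
  case empty
  interpret PM: product_sigma_finite "\<lambda>_. M"
    using M by (simp add: product_sigma_finite_def)
  interpret PN: product_sigma_finite "\<lambda>_. N"
    using N by (simp add: product_sigma_finite_def)
  show ?case
    by (simp add: PiM_empty lebesgue_integral_count_space_finite)
next
  case (insert i I)
  interpret M: sigma_finite_measure M by fact
  interpret PM: product_sigma_finite "\<lambda>_. M"
    using M by (simp add: product_sigma_finite_def)
  interpret PN: product_sigma_finite "\<lambda>_. N"
    using N by (simp add: product_sigma_finite_def)
  have inj: "inj_on \<phi> I" "\<phi> i \<notin> \<phi> ` I"
    using insert.prems(1) insert.hyps by (auto simp: inj_on_def)
  have neq: "\<phi> j \<noteq> \<phi> i" if "j \<in> I" for j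
    using inj(2) that by (metis imageI)
  \<comment> \<open>The variable \<open>i\<close> is integrated out on the side of \<open>M\<close>,
    and the result is a bounded measurable function of the remaining parameters, to which the
    induction hypothesis applies.\<close>
  define q' where "q' z = (LINT y|M. a i y * q ((\<lambda>j\<in>I. z j)(i := s y)))" for z
  have [measurable]: "a i \<in> borel_measurable M"
    using insert.prems(2)[of i] by auto
  note [measurable] = insert.prems(5) s
  have "(\<lambda>(z, y). (\<lambda>j\<in>I. z j)(i := s y)) \<in> PiM I (\<lambda>_. S) \<Otimes>\<^sub>M M \<rightarrow>\<^sub>M PiM (insert i I) (\<lambda>_. S)"
    unfolding case_prod_beta'
  proof (rule measurable_fun_upd[where J = I])
    show "(\<lambda>p. \<lambda>j\<in>I. fst p j) \<in> PiM I (\<lambda>_. S) \<Otimes>\<^sub>M M \<rightarrow>\<^sub>M PiM I (\<lambda>_. S)"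
      by measurable
    show "(\<lambda>p. s (snd p)) \<in> PiM I (\<lambda>_. S) \<Otimes>\<^sub>M M \<rightarrow>\<^sub>M S"
      by measurable
  qed auto
  then have [measurable]: "(\<lambda>(z, y). q ((\<lambda>j\<in>I. z j)(i := s y))) \<in> borel_measurable (PiM I (\<lambda>_. S) \<Otimes>\<^sub>M M)"
    using measurable_compose[OF _ insert.prems(5)] by (simp add: case_prod_beta')
  have q'_meas: "q' \<in> borel_measurable (PiM I (\<lambda>_. S))"
    unfolding q'_def by measurable
  have B: "B \<ge> 0"
    using insert.prems(6)[of undefined] norm_ge_zero order_trans by blast
  \<comment> \<open>The induction hypothesis asks for a bound at every argument, including points
    outside the space of the product measure.\<close>
  have q'_bound: "norm (q' z) \<le> (LINT y|M. norm (a i y) * B)" for z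
    unfolding q'_def using insert.prems(2)[of i] B insert.prems(6)
    by (intro order_trans[OF integral_norm_bound] integral_mono') (auto simp: norm_mult intro!: mult_left_mono)
  \<comment> \<open>With the other parameters frozen, \<open>q\<close> is a bounded measurable
    function of one parameter, so the hypothesis on \<open>a i\<close> and \<open>b i\<close>
    applies with this slice as \<open>\<psi>\<close>.\<close>
  have q'_eq: "q' z = (LINT y|N. b i y * q (z(i := t y)))" if z: "z \<in> space (PiM I (\<lambda>_. S))" for z
  proof -
    have r: "(\<lambda>j\<in>I. z j) = z"
      using z by (auto simp: space_PiM)
    have "(\<lambda>r. z(i := r)) \<in> S \<rightarrow>\<^sub>M PiM (insert i I) (\<lambda>_. S)"
      using z by (intro measurable_fun_upd) auto
    then have "(\<lambda>r. q (z(i := r))) \<in> borel_measurable S"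
      by (rule measurable_compose[OF _ insert.prems(5)])
    then show ?thesis
      unfolding q'_def r using insert.prems(6)
      by (intro insert.prems(4)) (auto simp only: bounded_iff)
  qed
  \<comment> \<open>Stated for a general index map \<open>\<theta>\<close>, since it is needed for
    \<open>\<phi>\<close> on the side of \<open>M\<close> and for the identity on the side of
    \<open>N\<close>; the same goes for \<open>prod_upd\<close>.\<close>
  have upd: "(\<lambda>j\<in>insert i I. u ((x(k := y)) (\<theta> j))) = (\<lambda>j\<in>I. u (x (\<theta> j)))(i := u y)"
    if "\<theta> i = k" "\<And>j. j \<in> I \<Longrightarrow> \<theta> j \<noteq> k" for u :: "'u \<Rightarrow> 's" and x :: "'v \<Rightarrow> 'u" and y k and \<theta> :: "'i \<Rightarrow> 'v"
    using that insert.hyps by (auto simp: fun_eq_iff)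
  have prod_upd: "(\<Prod>j\<in>insert i I. f j ((x(k := y)) (\<theta> j))) = f i y * (\<Prod>j\<in>I. f j (x (\<theta> j)))"
    if "\<theta> i = k" "\<And>j. j \<in> I \<Longrightarrow> \<theta> j \<noteq> k" for f :: "'i \<Rightarrow> 'u \<Rightarrow> complex" and x :: "'v \<Rightarrow> 'u" and y k and \<theta> :: "'i \<Rightarrow> 'v"
    using that insert.hyps by (auto intro!: prod.cong arg_cong2[where f = "(*)"])
  have "(LINT x|PiM (\<phi> ` insert i I) (\<lambda>_. M). (\<Prod>j\<in>insert i I. a j (x (\<phi> j))) * q (\<lambda>j\<in>insert i I. s (x (\<phi> j)))) =
    (LINT x|PiM (\<phi> ` I) (\<lambda>_. M). LINT y|M. (\<Prod>j\<in>insert i I. a j ((x(\<phi> i := y)) (\<phi> j))) *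
       q (\<lambda>j\<in>insert i I. s ((x(\<phi> i := y)) (\<phi> j))))"
    unfolding image_insert
  proof (rule PM.product_integral_insert)
    have "integrable (PiM (\<phi> ` insert i I) (\<lambda>_. M))
        (\<lambda>x. (\<Prod>j\<in>insert i I. a j (x (\<phi> j))) * q (\<lambda>j\<in>insert i I. s (x (\<phi> j))))"
      using insert.hyps
      by (intro integrable_PiM_prod_bounded[OF M _ insert.prems(1) s _ insert.prems(5,6)] insert.prems(2)) auto
    then show "integrable (PiM (insert (\<phi> i) (\<phi> ` I)) (\<lambda>_. M))
        (\<lambda>x. (\<Prod>j\<in>insert i I. a j (x (\<phi> j))) * q (\<lambda>j\<in>insert i I. s (x (\<phi> j))))"
      by simp
  qed (use inj insert.hyps in auto)
  also have "\<dots> = (LINT x|PiM (\<phi> ` I) (\<lambda>_. M). LINT y|M. (\<Prod>j\<in>I. a j (x (\<phi> j))) *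
       (a i y * q ((\<lambda>j\<in>I. s (x (\<phi> j)))(i := s y))))"
    by (simp only: upd[of \<phi> "\<phi> i", OF refl neq] prod_upd[of \<phi> "\<phi> i", OF refl neq] ac_simps)
  also have "\<dots> = (LINT x|PiM (\<phi> ` I) (\<lambda>_. M). (\<Prod>j\<in>I. a j (x (\<phi> j))) * q' (\<lambda>j\<in>I. s (x (\<phi> j))))"
    by (simp add: q'_def cong: restrict_cong)
  also have "\<dots> = (LINT x|PiM I (\<lambda>_. N). (\<Prod>j\<in>I. b j (x j)) * q' (\<lambda>j\<in>I. t (x j)))"
    using inj insert.prems(2-4) q'_meas q'_bound by (intro insert.IH) auto
  also have "\<dots> = (LINT x|PiM I (\<lambda>_. N). LINT y|N. (\<Prod>j\<in>I. b j (x j)) *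
       (b i y * q ((\<lambda>j\<in>I. t (x j))(i := t y))))"
  proof (intro Bochner_Integration.integral_cong refl)
    fix x assume "x \<in> space (PiM I (\<lambda>_. N))"
    then have "(\<lambda>j\<in>I. t (x j)) \<in> space (PiM I (\<lambda>_. S))"
      using measurable_space[OF t] by (auto simp: space_PiM)
    then show "(\<Prod>j\<in>I. b j (x j)) * q' (\<lambda>j\<in>I. t (x j)) = (LINT y|N. (\<Prod>j\<in>I. b j (x j)) *
       (b i y * q ((\<lambda>j\<in>I. t (x j))(i := t y))))"
      by (simp add: q'_eq)
  qed
  also have "\<dots> = (LINT x|PiM I (\<lambda>_. N). LINT y|N. (\<Prod>j\<in>insert i I. b j ((x(i := y)) j)) *
       q (\<lambda>j\<in>insert i I. t ((x(i := y)) j)))"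
  proof -
    have neq': "j \<noteq> i" if "j \<in> I" for j
      using that insert.hyps by auto
    show ?thesis
      by (simp only: upd[of "\<lambda>j. j" i, OF refl neq'] prod_upd[of "\<lambda>j. j" i, OF refl neq'] ac_simps)
  qed
  also have "\<dots> = (LINT x|PiM (insert i I) (\<lambda>_. N). (\<Prod>j\<in>insert i I. b j (x j)) * q (\<lambda>j\<in>insert i I. t (x j)))"
  proof (rule PN.product_integral_insert[symmetric])
    have "integrable (PiM ((\<lambda>j. j) ` insert i I) (\<lambda>_. N))
        (\<lambda>x. (\<Prod>j\<in>insert i I. b j (x j)) * q (\<lambda>j\<in>insert i I. t (x j)))"
      using insert.hyps
      by (intro integrable_PiM_prod_bounded[OF N _ inj_on_id2 t _ insert.prems(5,6)] insert.prems(3)) auto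
    then show "integrable (PiM (insert i I) (\<lambda>_. N))
        (\<lambda>x. (\<Prod>j\<in>insert i I. b j (x j)) * q (\<lambda>j\<in>insert i I. t (x j)))"
      by simp
  qed (use insert.hyps in auto)
  finally show ?case .
qed

section \<open>Histories of the vacuum\<close>

text \<open>An invariant of the steps. From the empty word only created letters can be deleted, and
  steps run downwards, so a letter created at step \<open>j\<close> is deleted at a step with a
  smaller number. If the final word is empty, every creation is thereby matched with a
  deletion.\<close>

lemma histories_pairing:
  assumes "H \<in> set (histories sg k 0 r)" "r \<le> k"
  shows "set (word H) \<subseteq> Created ` {j \<in> {k - r<..k}. sg j = Plus} \<and>
    (\<forall>j\<in>{k - r<..k}. sg j = Plus \<longrightarrow> yvar H j = Created j \<and>
       (Created j \<in> set (word H) \<or> (\<exists>j'\<in>{k - r<..<j}. sg j' = Minus \<and> yvar H j' = Created j))) \<and>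
    (\<forall>j\<in>{k - r<..k}. sg j = Minus \<longrightarrow> (\<exists>j'\<in>{j<..k}. sg j' = Plus \<and> yvar H j = Created j'))"
  using assms
proof (induction r arbitrary: H)
  case 0
  then show ?case by auto
next
  case (Suc r)
  then obtain G where G: "G \<in> set (histories sg k 0 r)"
    and H: "H \<in> set (history_step (sg (k - r)) (k - r) G)"
    by auto
  obtain w a p D where G_eq: "G = History w a p D" by (cases G)
  \<comment> \<open>\<open>m\<close> is the number of the step being carried out; the steps done
    before it are \<open>m + 1, ..., k\<close>.\<close>
  define m where "m = k - r"
  have m: "k - Suc r = m - 1" "m > 0" "m \<le> k" "k - r = m"
    using Suc.prems by (auto simp: m_def)
  have eq: "{m - 1<..k} = insert m {m<..k}"
    using m by auto
  have IH: "set w \<subseteq> Created ` {j \<in> {m<..k}. sg j = Plus}"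
    "\<And>j. j \<in> {m<..k} \<Longrightarrow> sg j = Plus \<Longrightarrow> a j = Created j \<and>
       (Created j \<in> set w \<or> (\<exists>j'\<in>{m<..<j}. sg j' = Minus \<and> a j' = Created j))"
    "\<And>j. j \<in> {m<..k} \<Longrightarrow> sg j = Minus \<Longrightarrow> (\<exists>j'\<in>{j<..k}. sg j' = Plus \<and> a j = Created j')"
    using Suc.IH[OF G] Suc.prems m by (auto simp: G_eq)
  show ?case
  proof (cases "sg m")
    case Plus
    then have H_eq: "H = History (Created m # w) (a(m := Created m)) p D"
      using H by (simp add: G_eq m)
    have 1: "set (Created m # w) \<subseteq> Created ` {j \<in> {m - 1<..k}. sg j = Plus}"
      using IH(1) Plus unfolding eq by auto
    have 2: "(a(m := Created m)) j = Created j \<and>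
       (Created j \<in> set (Created m # w) \<or>
         (\<exists>j'\<in>{m - 1<..<j}. sg j' = Minus \<and> (a(m := Created m)) j' = Created j))"
      if j: "j \<in> {m - 1<..k}" "sg j = Plus" for j
    proof (cases "j = m")
      case False
      with j have jm: "j \<in> {m<..k}" by (auto simp: eq)
      have "\<exists>j'\<in>{m - 1<..<j}. sg j' = Minus \<and> (a(m := Created m)) j' = Created j"
        if "j' \<in> {m<..<j}" "sg j' = Minus" "a j' = Created j" for j'
        using that by (intro bexI[of _ j']) auto
      moreover have "(a(m := Created m)) j = Created j"
        using IH(2)[OF jm j(2)] False by simp
      moreover have "set w \<subseteq> set (Created m # w)"
        by auto
      ultimately show ?thesis
        using IH(2)[OF jm j(2)] by blast
    qed simp
    have 3: "\<exists>j'\<in>{j<..k}. sg j' = Plus \<and> (a(m := Created m)) j = Created j'"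
      if j: "j \<in> {m - 1<..k}" "sg j = Minus" for j
    proof -
      have "j \<noteq> m" using j Plus by auto
      then have jm: "j \<noteq> m" "j \<in> {m<..k}" using j by (auto simp: eq)
      then show ?thesis
        using IH(3)[OF jm(2) j(2)] by auto
    qed
    show ?thesis
      unfolding m H_eq history.sel using 1 2 3 by blast
  next
    case Minus
    then obtain l where l: "l < length w"
      and H_eq: "H = History (take l w @ drop (Suc l) w) (a(m := w ! l))
            (p @ map (\<lambda>u. (w ! l, u)) (take l w)) (insert (w ! l) D)"
      using H by (auto simp: G_eq m)
    have w: "set w = insert (w ! l) (set (take l w @ drop (Suc l) w))"
      using l by (metis id_take_nth_drop Un_insert_right list.simps(15) set_append)
    obtain j1 where j1: "j1 \<in> {m<..k}" "sg j1 = Plus" "w ! l = Created j1"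
    proof -
      have "w ! l \<in> Created ` {j \<in> {m<..k}. sg j = Plus}"
        using IH(1) nth_mem[OF l] by blast
      then show ?thesis
        using that by auto
    qed
    have 1: "set (take l w @ drop (Suc l) w) \<subseteq> Created ` {j \<in> {m - 1<..k}. sg j = Plus}"
    proof -
      have "set (take l w @ drop (Suc l) w) \<subseteq> set w"
        using w by blast
      then show ?thesis
        using IH(1) unfolding eq by blast
    qed
    have 2: "(a(m := w ! l)) j = Created j \<and>
       (Created j \<in> set (take l w @ drop (Suc l) w) \<or>
         (\<exists>j'\<in>{m - 1<..<j}. sg j' = Minus \<and> (a(m := w ! l)) j' = Created j))"
      if j: "j \<in> {m - 1<..k}" "sg j = Plus" for j
    proof -
      have "j \<noteq> m" using j Minus by auto
      then have jm: "j \<in> {m<..k}" "j \<noteq> m"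
        using j by (auto simp: eq)
      have aj: "(a(m := w ! l)) j = Created j"
        using IH(2)[OF jm(1) j(2)] jm(2) by simp
      consider "Created j = w ! l" | "Created j \<in> set (take l w @ drop (Suc l) w)"
        | j' where "j' \<in> {m<..<j}" "sg j' = Minus" "a j' = Created j"
        using IH(2)[OF jm(1) j(2)] w by blast
      then show ?thesis
      proof cases
        case 1
        \<comment> \<open>The letter of \<open>j\<close> is the one deleted now, so the current step
          \<open>m\<close> is the required witness.\<close>
        then have "\<exists>j'\<in>{m - 1<..<j}. sg j' = Minus \<and> (a(m := w ! l)) j' = Created j"
          using jm m Minus by (intro bexI[of _ m]) auto
        then show ?thesis
          using aj by blast
      next
        case 2
        then show ?thesis
          using aj by blast
      next
        case 3
        then have "\<exists>j'\<in>{m - 1<..<j}. sg j' = Minus \<and> (a(m := w ! l)) j' = Created j"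
          by (intro bexI[of _ j']) auto
        then show ?thesis
          using aj by blast
      qed
    qed
    have 3: "\<exists>j'\<in>{j<..k}. sg j' = Plus \<and> (a(m := w ! l)) j = Created j'"
      if j: "j \<in> {m - 1<..k}" "sg j = Minus" for j
    proof (cases "j = m")
      case True
      then show ?thesis using j1 by auto
    next
      case False
      with j have "j \<in> {m<..k}" by (auto simp: eq)
      then show ?thesis
        using IH(3) j(2) False by auto
    qed
    show ?thesis
      unfolding m H_eq history.sel using 1 2 3 by blast
  qed
qed

section \<open>Histories consisting of n creations followed by n deletions\<close>

text \<open>Translates the positional operations of \<open>history_step\<close> into conditions on
  values: in a strictly increasing list the entries before a given one are exactly the smaller
  ones.\<close>

lemma filter_strict_sorted_nth:
  fixes u :: "'a::linorder list"
  assumes "sorted_wrt (<) u" "l < length u"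
  shows "filter (\<lambda>p. p < u ! l) u = take l u"
    and "filter (\<lambda>p. p \<noteq> u ! l) u = take l u @ drop (Suc l) u"
proof -
  define x y v where "x = take l u" and "y = drop (Suc l) u" and "v = u ! l"
  have u: "u = x @ v # y"
    using assms by (simp add: x_def y_def v_def id_take_nth_drop)
  have "\<forall>p\<in>set x. p < v" "\<forall>p\<in>set y. v < p"
    using assms(1) by (auto simp: u sorted_wrt_append)
  then have "filter (\<lambda>p. p < v) x = x" "filter (\<lambda>p. p < v) y = []"
    "filter (\<lambda>p. p \<noteq> v) x = x" "filter (\<lambda>p. p \<noteq> v) y = y"
    by (auto simp: filter_id_conv filter_empty_conv)
  then have "filter (\<lambda>p. p < v) u = x" "filter (\<lambda>p. p \<noteq> v) u = x @ y"
    by (simp_all add: u)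
  then show "filter (\<lambda>p. p < u ! l) u = take l u"
    "filter (\<lambda>p. p \<noteq> u ! l) u = take l u @ drop (Suc l) u"
    by (simp_all add: x_def y_def v_def)
qed

text \<open>Creations offer no choice, so there is a single history. Putting the letters in front
  while the step number decreases leaves a word with increasing numbers.\<close>

lemma histories_creation:
  assumes "\<And>j. j \<in> {n<..2 * n} \<Longrightarrow> sg j = Plus" "r \<le> n"
  shows "histories sg (2 * n) 0 r =
    [History (map Created [Suc (2 * n - r)..<Suc (2 * n)])
       (\<lambda>j. if j \<in> {2 * n - r<..2 * n} then Created j else undefined) [] {}]"
  using assms(2)
proof (induction r)
  case 0
  then show ?case by auto
next
  case (Suc r)
  define m where "m = 2 * n - r"
  have m: "2 * n - Suc r = m - 1" "0 < m" "m \<le> 2 * n" "2 * n - r = m" "n < m"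
    using Suc.prems by (auto simp: m_def)
  have "Suc (m - 1) = m" using m by simp
  moreover have "[m..<Suc (2 * n)] = m # [Suc m..<Suc (2 * n)]"
    using m by (simp add: upt_conv_Cons)
  ultimately show ?case
    using Suc m by (auto simp: assms(1) fun_eq_iff simp del: upt_Suc)
qed

text \<open>The state after all \<open>n\<close> creations and \<open>m\<close> deletions, the \<open>i\<close>-th deletion (at step
  \<open>j = n + 1 - i\<close>) having removed the letter created at step \<open>n + \<sigma> i\<close>.\<close>

definition deletion_history :: "nat \<Rightarrow> nat \<Rightarrow> (nat \<Rightarrow> nat) \<Rightarrow> history" where
  "deletion_history n m \<sigma> = History
     (map (\<lambda>p. Created (n + p)) (filter (\<lambda>p. p \<notin> \<sigma> ` {1..m}) [1..<Suc n]))
     (\<lambda>j. if j \<in> {n - m<..n} then Created (n + \<sigma> (Suc n - j))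
          else if j \<in> {n<..2 * n} then Created j else undefined)
     (concat (map (\<lambda>i. map (\<lambda>p. (Created (n + \<sigma> i), Created (n + p)))
        (filter (\<lambda>p. p < \<sigma> i \<and> p \<notin> \<sigma> ` {1..i}) [1..<Suc n])) [1..<Suc m]))
     ((\<lambda>i. Created (n + \<sigma> i)) ` {1..m})"

text \<open>Allows an injection defined on \<open>{1..n}\<close> only to be replaced by the
  permutation extending it.\<close>

lemma deletion_history_cong:
  assumes "\<And>i. i \<in> {1..m} \<Longrightarrow> \<sigma> i = \<sigma>' i" "m \<le> n"
  shows "deletion_history n m \<sigma> = deletion_history n m \<sigma>'"
proof -
  have 1: "\<sigma> ` {1..i} = \<sigma>' ` {1..i}" if "i \<le> m" for i
    using assms(1) that by (intro image_cong) auto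
  have 2: "\<sigma> (Suc n - j) = \<sigma>' (Suc n - j)" if "j \<in> {n - m<..n}" for j
    using that assms by (intro assms(1)) auto
  have 3: "concat (map (\<lambda>i. map (\<lambda>p. (Created (n + \<sigma> i), Created (n + p)))
        (filter (\<lambda>p. p < \<sigma> i \<and> p \<notin> \<sigma> ` {1..i}) [1..<Suc n])) [1..<Suc m]) =
      concat (map (\<lambda>i. map (\<lambda>p. (Created (n + \<sigma>' i), Created (n + p)))
        (filter (\<lambda>p. p < \<sigma>' i \<and> p \<notin> \<sigma>' ` {1..i}) [1..<Suc n])) [1..<Suc m])"
    using 1 assms(1) by (intro arg_cong[where f = concat] map_cong refl) (auto simp del: upt_Suc)
  have 4: "(\<lambda>i. Created (n + \<sigma> i)) ` {1..m} = (\<lambda>i. Created (n + \<sigma>' i)) ` {1..m}"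
    using assms(1) by (intro image_cong) auto
  show ?thesis
    unfolding deletion_history_def 3 4 1[OF order_refl] using 2 by (simp cong: if_cong)
qed

lemma history_step_deletion:
  assumes "m < n"
  shows "history_step Minus (n - m) (deletion_history n m \<sigma>) =
    map (\<lambda>v. deletion_history n (Suc m) (\<sigma>(Suc m := v))) (filter (\<lambda>p. p \<notin> \<sigma> ` {1..m}) [1..<Suc n])"
proof -
  \<comment> \<open>The numbers of the letters still present, in the order of the word.\<close>
  define u where "u = filter (\<lambda>p. p \<notin> \<sigma> ` {1..m}) [1..<Suc n]"
  have u: "sorted_wrt (<) u"
    unfolding u_def by (intro sorted_wrt_filter) (simp del: upt_Suc)
  define w a p D where "w = map (\<lambda>p. Created (n + p)) u"
    and "a = yvar (deletion_history n m \<sigma>)" and "p = factors (deletion_history n m \<sigma>)"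
    and "D = deleted (deletion_history n m \<sigma>)"
  have eq: "deletion_history n m \<sigma> = History w a p D"
    by (simp add: deletion_history_def w_def u_def a_def p_def D_def del: upt_Suc)
  have "History (take l w @ drop (Suc l) w) (a(n - m := w ! l))
            (p @ map (\<lambda>u. (w ! l, u)) (take l w)) (insert (w ! l) D) =
        deletion_history n (Suc m) (\<sigma>(Suc m := u ! l))" if l: "l < length u" for l
  proof -
    define v where "v = u ! l"
    define \<rho> where "\<rho> = \<sigma>(Suc m := v)"
    have \<rho>: "\<rho> i = \<sigma> i" if "i \<in> {1..m}" for i
      using that by (simp add: \<rho>_def)
    have \<rho>_img: "\<rho> ` {1..i} = \<sigma> ` {1..i}" if "i \<le> m" for i
      using that \<rho> by (intro image_cong) auto
    have \<rho>_img': "\<rho> ` {1..Suc m} = insert v (\<sigma> ` {1..m})"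
    proof -
      have "{1..Suc m} = insert (Suc m) {1..m}" by auto
      then have "\<rho> ` {1..Suc m} = insert (\<rho> (Suc m)) (\<rho> ` {1..m})" by simp
      then show ?thesis
        unfolding \<rho>_img[OF order_refl] by (simp add: \<rho>_def)
    qed
    have wl: "w ! l = Created (n + v)"
      using l by (simp add: w_def v_def)
    have 1: "take l w @ drop (Suc l) w =
        map (\<lambda>p. Created (n + p)) (filter (\<lambda>p. p \<notin> \<rho> ` {1..Suc m}) [1..<Suc n])"
    proof -
      have "filter (\<lambda>p. p \<notin> \<rho> ` {1..Suc m}) [1..<Suc n] = filter (\<lambda>p. p \<noteq> v) u"
        unfolding u_def filter_filter \<rho>_img' by (intro filter_cong) auto
      then show ?thesis
        using filter_strict_sorted_nth(2)[OF u l]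
        by (simp add: v_def w_def take_map drop_map)
    qed
    have 2: "a(n - m := w ! l) = (\<lambda>j. if j \<in> {n - Suc m<..n} then Created (n + \<rho> (Suc n - j))
          else if j \<in> {n<..2 * n} then Created j else undefined)"
    proof
      fix j
      consider "j = n - m" | "j \<in> {n - m<..n}" | "j \<notin> {n - Suc m<..n}"
        using assms by force
      then show "(a(n - m := w ! l)) j = (if j \<in> {n - Suc m<..n} then Created (n + \<rho> (Suc n - j))
          else if j \<in> {n<..2 * n} then Created j else undefined)"
      proof cases
        case 1
        \<comment> \<open>For \<open>j = n - m\<close> the argument \<open>Suc n - j\<close> is
          \<open>Suc m\<close>, where \<open>\<rho>\<close> has the new value
          \<open>v\<close>.\<close>
        then show ?thesis
          using assms by (auto simp: wl \<rho>_def Suc_diff_le)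
      next
        case 2
        then have "\<rho> (Suc n - j) = \<sigma> (Suc n - j)"
          using assms by (intro \<rho>) auto
        then show ?thesis
          using 2 assms by (auto simp: a_def deletion_history_def)
      next
        case 3
        then show ?thesis
          using assms by (auto simp: a_def deletion_history_def)
      qed
    qed
    have "map (\<lambda>u. (w ! l, u)) (take l w) = map (\<lambda>p. (Created (n + v), Created (n + p)))
        (filter (\<lambda>p. p < v) u)"
      using filter_strict_sorted_nth(1)[OF u l] by (simp add: wl) (simp add: w_def take_map v_def)
    \<comment> \<open>Excluding the new value \<open>v\<close> as well changes nothing, because only
      entries below \<open>v\<close> are kept.\<close>
    also have "filter (\<lambda>p. p < v) u = filter (\<lambda>p. p < \<rho> (Suc m) \<and> p \<notin> \<rho> ` {1..Suc m}) [1..<Suc n]"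
      unfolding u_def filter_filter \<rho>_img' by (intro filter_cong) (auto simp: \<rho>_def)
    also have "Created (n + v) = Created (n + \<rho> (Suc m))"
      by (simp add: \<rho>_def)
    finally have "p @ map (\<lambda>u. (w ! l, u)) (take l w) =
        concat (map (\<lambda>i. map (\<lambda>p. (Created (n + \<sigma> i), Created (n + p)))
          (filter (\<lambda>p. p < \<sigma> i \<and> p \<notin> \<sigma> ` {1..i}) [1..<Suc n])) [1..<Suc m]) @
        map (\<lambda>p. (Created (n + \<rho> (Suc m)), Created (n + p)))
          (filter (\<lambda>p. p < \<rho> (Suc m) \<and> p \<notin> \<rho> ` {1..Suc m}) [1..<Suc n])"
      by (simp add: p_def deletion_history_def del: upt_Suc)
    also have "map (\<lambda>i. map (\<lambda>p. (Created (n + \<sigma> i), Created (n + p)))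
          (filter (\<lambda>p. p < \<sigma> i \<and> p \<notin> \<sigma> ` {1..i}) [1..<Suc n])) [1..<Suc m] =
        map (\<lambda>i. map (\<lambda>p. (Created (n + \<rho> i), Created (n + p)))
          (filter (\<lambda>p. p < \<rho> i \<and> p \<notin> \<rho> ` {1..i}) [1..<Suc n])) [1..<Suc m]"
      using \<rho> \<rho>_img by (intro map_cong refl) (auto simp del: upt_Suc)
    also have "concat \<dots> @ map (\<lambda>p. (Created (n + \<rho> (Suc m)), Created (n + p)))
          (filter (\<lambda>p. p < \<rho> (Suc m) \<and> p \<notin> \<rho> ` {1..Suc m}) [1..<Suc n]) =
        concat (map (\<lambda>i. map (\<lambda>p. (Created (n + \<rho> i), Created (n + p)))
          (filter (\<lambda>p. p < \<rho> i \<and> p \<notin> \<rho> ` {1..i}) [1..<Suc n])) [1..<Suc (Suc m)])"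
      by (simp only: upt_Suc[of 1 "Suc m"]) simp
    finally have 3: "p @ map (\<lambda>u. (w ! l, u)) (take l w) = \<dots>" .
    have 4: "insert (w ! l) D = (\<lambda>i. Created (n + \<rho> i)) ` {1..Suc m}"
    proof -
      have "(\<lambda>i. Created (n + \<rho> i)) ` {1..Suc m} = (\<lambda>p. Created (n + p)) ` \<rho> ` {1..Suc m}"
        by (simp only: image_image)
      also have "\<dots> = insert (w ! l) D"
        unfolding \<rho>_img' wl by (simp add: D_def deletion_history_def image_image)
      finally show ?thesis by simp
    qed
    show ?thesis
      unfolding 1 2 3 4 deletion_history_def \<rho>_def[symmetric] v_def[symmetric] by (rule refl)
  qed
  then show ?thesis
    unfolding eq u_def[symmetric] by (intro nth_equalityI) (auto simp: w_def)
qed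

lemma sum_histories_deletion:
  fixes F :: "history \<Rightarrow> 'a::comm_monoid_add"
  assumes plus: "\<And>j. j \<in> {n<..2 * n} \<Longrightarrow> sg j = Plus" and minus: "\<And>j. j \<in> {1..n} \<Longrightarrow> sg j = Minus"
    and "m \<le> n"
  shows "(\<Sum>H\<leftarrow>histories sg (2 * n) 0 (n + m). F H) =
    (\<Sum>\<sigma> | \<sigma> \<in> {1..m} \<rightarrow>\<^sub>E {1..n} \<and> inj_on \<sigma> {1..m}. F (deletion_history n m \<sigma>))"
  using assms(3)
proof (induction m arbitrary: F)
  case 0
  have "History (map Created [Suc n..<Suc (2 * n)])
       (\<lambda>j. if j \<in> {n<..2 * n} then Created j else undefined) [] {} = deletion_history n 0 (\<lambda>_. undefined)"
  proof -
    have "map Created [Suc n..<Suc (2 * n)] = map (\<lambda>p. Created (n + p)) [1..<Suc n]"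
      by (rule nth_equalityI) (auto simp del: upt_Suc)
    then show ?thesis
      by (auto simp: deletion_history_def fun_eq_iff simp del: upt_Suc)
  qed
  moreover have "{\<sigma>. \<sigma> \<in> {1..0::nat} \<rightarrow>\<^sub>E {1..n} \<and> inj_on \<sigma> {1..0}} = {\<lambda>_. undefined}"
    by auto
  ultimately show ?case
    using histories_creation[of n sg n, OF plus] by (simp add: mult_2 del: upt_Suc)
next
  case (Suc m)
  define S where "S m = {\<sigma>. \<sigma> \<in> {1..m} \<rightarrow>\<^sub>E {1..n} \<and> inj_on \<sigma> {1..m}}" for m :: nat
  have fin: "finite (S m)"
    unfolding S_def by (rule finite_subset[OF _ finite_PiE[of "{1..m}" "\<lambda>_. {1..n}"]]) auto
  have "(\<Sum>H\<leftarrow>histories sg (2 * n) 0 (n + Suc m). F H) =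
      (\<Sum>H\<leftarrow>histories sg (2 * n) 0 (n + m). \<Sum>H'\<leftarrow>history_step (sg (n - m)) (n - m) H. F H')"
  proof -
    have "(\<Sum>H\<leftarrow>concat (map G Hs). F H) = (\<Sum>H\<leftarrow>Hs. \<Sum>H'\<leftarrow>G H. F H')" for G and Hs :: "history list"
      by (induction Hs) simp_all
    then show ?thesis
      by simp
  qed
  \<comment> \<open>The induction hypothesis is applied to the function that sums \<open>F\<close>
    over the successors of a history; hence the arbitrary \<open>F\<close>.\<close>
  also have "\<dots> = (\<Sum>\<sigma>\<in>S m. \<Sum>H'\<leftarrow>history_step Minus (n - m) (deletion_history n m \<sigma>). F H')"
    unfolding S_def using Suc by (subst Suc.IH) (auto simp: minus)
  also have "\<dots> = (\<Sum>\<sigma>\<in>S m. \<Sum>v\<in>{1..n} - \<sigma> ` {1..m}. F (deletion_history n (Suc m) (\<sigma>(Suc m := v))))"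
  proof (intro sum.cong refl)
    fix \<sigma>
    have "set (filter (\<lambda>p. p \<notin> \<sigma> ` {1..m}) [1..<Suc n]) = {1..n} - \<sigma> ` {1..m}"
      by auto
    moreover have "distinct (filter (\<lambda>p. p \<notin> \<sigma> ` {1..m}) [1..<Suc n])"
      by (intro distinct_filter distinct_upt)
    ultimately show "(\<Sum>H'\<leftarrow>history_step Minus (n - m) (deletion_history n m \<sigma>). F H') =
        (\<Sum>v\<in>{1..n} - \<sigma> ` {1..m}. F (deletion_history n (Suc m) (\<sigma>(Suc m := v))))"
      using Suc.prems
      by (simp add: history_step_deletion comp_def sum_list_distinct_conv_sum_set del: upt_Suc)
  qed
  also have "\<dots> = (\<Sum>(\<sigma>, v)\<in>(SIGMA \<sigma>:S m. {1..n} - \<sigma> ` {1..m}). F (deletion_history n (Suc m) (\<sigma>(Suc m := v))))"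
    using fin by (simp add: sum.Sigma)
  \<comment> \<open>An injection on \<open>{1..Suc m}\<close> is the same as its restriction to
    \<open>{1..m}\<close> together with a value not taken there.\<close>
  also have "\<dots> = (\<Sum>\<sigma>\<in>S (Suc m). F (deletion_history n (Suc m) \<sigma>))"
  proof (rule sum.reindex_bij_witness[where j = "\<lambda>(\<sigma>, v). \<sigma>(Suc m := v)"
        and i = "\<lambda>\<sigma>. (restrict \<sigma> {1..m}, \<sigma> (Suc m))"])
    fix \<sigma> assume "\<sigma> \<in> S (Suc m)"
    then have \<sigma>: "\<sigma> \<in> {1..Suc m} \<rightarrow>\<^sub>E {1..n}" "inj_on \<sigma> {1..Suc m}"
      by (auto simp: S_def)
    show "(case (restrict \<sigma> {1..m}, \<sigma> (Suc m)) of (\<sigma>, v) \<Rightarrow> \<sigma>(Suc m := v)) = \<sigma>"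
      using \<sigma>(1) by (auto simp: fun_eq_iff PiE_iff extensional_def)
    have "inj_on \<sigma> {1..m}" "\<sigma> (Suc m) \<notin> \<sigma> ` {1..m}"
    proof -
      have "{1..Suc m} = insert (Suc m) {1..m}" "{1..m} - {Suc m} = {1..m}" by auto
      then show "inj_on \<sigma> {1..m}" "\<sigma> (Suc m) \<notin> \<sigma> ` {1..m}"
        using \<sigma>(2) by (metis inj_on_insert)+
    qed
    then show "(restrict \<sigma> {1..m}, \<sigma> (Suc m)) \<in> (SIGMA \<sigma>:S m. {1..n} - \<sigma> ` {1..m})"
      using \<sigma>(1) by (auto simp: S_def PiE_iff)
  next
    fix z assume "z \<in> (SIGMA \<sigma>:S m. {1..n} - \<sigma> ` {1..m})"
    then obtain \<sigma> v where z: "z = (\<sigma>, v)"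
      and \<sigma>: "\<sigma> \<in> {1..m} \<rightarrow>\<^sub>E {1..n}" "inj_on \<sigma> {1..m}" "v \<in> {1..n}" "v \<notin> \<sigma> ` {1..m}"
      by (auto simp: S_def)
    show "(restrict (case z of (\<sigma>, v) \<Rightarrow> \<sigma>(Suc m := v)) {1..m},
        (case z of (\<sigma>, v) \<Rightarrow> \<sigma>(Suc m := v)) (Suc m)) = z"
      using \<sigma>(1) by (auto simp: z fun_eq_iff PiE_iff extensional_def)
    have "{1..Suc m} = insert (Suc m) {1..m}" by auto
    moreover have "inj_on (\<sigma>(Suc m := v)) {1..m}" "(\<sigma>(Suc m := v)) ` {1..m} = \<sigma> ` {1..m}"
    proof -
      have "(\<sigma>(Suc m := v)) i = \<sigma> i" if "i \<in> {1..m}" for i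
        using that by simp
      then show "inj_on (\<sigma>(Suc m := v)) {1..m}" "(\<sigma>(Suc m := v)) ` {1..m} = \<sigma> ` {1..m}"
        using \<sigma>(2) inj_on_cong[of "{1..m}" "\<sigma>(Suc m := v)" \<sigma>] image_cong[of "{1..m}" "{1..m}" "\<sigma>(Suc m := v)" \<sigma>]
        by blast+
    qed
    ultimately show "(case z of (\<sigma>, v) \<Rightarrow> \<sigma>(Suc m := v)) \<in> S (Suc m)"
      using \<sigma> by (auto simp: S_def z PiE_iff extensional_def)
  qed auto
  finally show ?case
    by (simp add: S_def)
qed

text \<open>An injection of the finite set \<open>{1..n}\<close> into itself is bijective and
  becomes a permutation once extended by the identity.\<close>

lemma sum_histories_permutations:
  fixes F :: "history \<Rightarrow> 'a::comm_monoid_add"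
  assumes "\<And>j. j \<in> {n<..2 * n} \<Longrightarrow> sg j = Plus" "\<And>j. j \<in> {1..n} \<Longrightarrow> sg j = Minus"
  shows "(\<Sum>H\<leftarrow>histories sg (2 * n) 0 (2 * n). F H) =
    (\<Sum>\<pi> | \<pi> permutes {1..n}. F (deletion_history n n \<pi>))"
proof -
  have "(\<Sum>H\<leftarrow>histories sg (2 * n) 0 (n + n). F H) =
    (\<Sum>\<sigma> | \<sigma> \<in> {1..n} \<rightarrow>\<^sub>E {1..n} \<and> inj_on \<sigma> {1..n}. F (deletion_history n n \<sigma>))"
    by (rule sum_histories_deletion) (use assms in auto)
  also have "\<dots> = (\<Sum>\<pi> | \<pi> permutes {1..n}. F (deletion_history n n \<pi>))"
  proof (rule sum.reindex_bij_witness[where j = "\<lambda>\<sigma> i. if i \<in> {1..n} then \<sigma> i else i"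
        and i = "\<lambda>\<pi>. restrict \<pi> {1..n}"])
    fix \<pi> assume "\<pi> \<in> {\<pi>. \<pi> permutes {1..n}}"
    then have \<pi>: "\<pi> permutes {1..n}" by simp
    show "(\<lambda>i. if i \<in> {1..n} then restrict \<pi> {1..n} i else i) = \<pi>"
      using permutes_not_in[OF \<pi>] by (auto simp: fun_eq_iff)
    show "restrict \<pi> {1..n} \<in> {\<sigma>. \<sigma> \<in> {1..n} \<rightarrow>\<^sub>E {1..n} \<and> inj_on \<sigma> {1..n}}"
      using permutes_in_image[OF \<pi>] permutes_inj_on[OF \<pi>] by (auto simp: PiE_iff)
  next
    fix \<sigma> assume "\<sigma> \<in> {\<sigma>. \<sigma> \<in> {1..n} \<rightarrow>\<^sub>E {1..n} \<and> inj_on \<sigma> {1..n}}"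
    then have \<sigma>: "\<sigma> \<in> {1..n} \<rightarrow>\<^sub>E {1..n}" "inj_on \<sigma> {1..n}" by auto
    show "restrict (\<lambda>i. if i \<in> {1..n} then \<sigma> i else i) {1..n} = \<sigma>"
      using \<sigma>(1) by (auto simp: fun_eq_iff PiE_iff extensional_def)
    have "\<sigma> ` {1..n} = {1..n}"
      using \<sigma> by (intro endo_inj_surj) auto
    then have "bij_betw \<sigma> {1..n} {1..n}"
      using \<sigma> by (simp add: bij_betw_def)
    then have "bij_betw (\<lambda>i. if i \<in> {1..n} then \<sigma> i else i) {1..n} {1..n}"
      by (rule bij_betw_cong[THEN iffD1, rotated]) simp
    then show "(\<lambda>i. if i \<in> {1..n} then \<sigma> i else i) \<in> {\<pi>. \<pi> permutes {1..n}}"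
      by (auto intro: bij_imp_permutes)
    show "F (deletion_history n n (\<lambda>i. if i \<in> {1..n} then \<sigma> i else i)) = F (deletion_history n n \<sigma>)"
      by (intro arg_cong[where f = F] deletion_history_cong) auto
  qed
  finally show ?thesis by (simp add: mult_2)
qed

section \<open>Complexified operators\<close>

lemma L2_Re_Im:
  assumes "h \<in> L2 M"
  shows "(\<lambda>x. Re (h x)) \<in> L2 M" "(\<lambda>x. Im (h x)) \<in> L2 M"
proof -
  have [measurable]: "h \<in> borel_measurable M" and i: "integrable M (\<lambda>x. (norm (h x))\<^sup>2)"
    using assms by (auto simp: L2_def)
  have "integrable M (\<lambda>x. (Re (h x))\<^sup>2)" "integrable M (\<lambda>x. (Im (h x))\<^sup>2)"
    by (rule Bochner_Integration.integrable_bound[OF i]; simp add: cmod_power2)+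
  then show "(\<lambda>x. Re (h x)) \<in> L2 M" "(\<lambda>x. Im (h x)) \<in> L2 M"
    by (auto simp: L2_real)
qed

lemma L2_mult_bounded:
  fixes f :: "'a \<Rightarrow> real"
  assumes "f \<in> L2 M" "p \<in> borel_measurable M" "\<And>x. \<bar>p x\<bar> \<le> B"
  shows "(\<lambda>x. p x * f x) \<in> L2 M"
proof -
  have "integrable M (\<lambda>x. (p x * f x)\<^sup>2)"
  proof (rule Bochner_Integration.integrable_bound)
    show "integrable M (\<lambda>x. B\<^sup>2 * (f x)\<^sup>2)"
      using assms(1) by (simp add: L2_real)
    have "(p x * f x)\<^sup>2 \<le> B\<^sup>2 * (f x)\<^sup>2" for x
      using power_mono[OF assms(3)[of x] abs_ge_zero, of 2] by (auto simp: power_mult_distrib intro: mult_right_mono)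
    then show "AE x in M. norm ((p x * f x)\<^sup>2) \<le> norm (B\<^sup>2 * (f x)\<^sup>2)"
      by simp
  qed (use assms in \<open>auto simp: L2_real\<close>)
  then show ?thesis
    using assms(1,2) by (auto simp: L2_real)
qed

lemma L2_operator_closed: "L2_operator M K \<Longrightarrow> f \<in> L2 M \<Longrightarrow> K f \<in> L2 M"
  by (simp add: L2_operator_def)

text \<open>Written in the shape of \<open>complexify\<close>, so that complex integrals reduce to
  integrals of products of real L2 functions.\<close>

lemma complex_integrable_of_real_parts:
  assumes "integrable M X" "integrable M Y"
  shows "integrable M (\<lambda>x. complex_of_real (X x) + \<i> * complex_of_real (Y x))"
    and "(LINT x|M. complex_of_real (X x) + \<i> * complex_of_real (Y x)) =
      complex_of_real (LINT x|M. X x) + \<i> * complex_of_real (LINT x|M. Y x)"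
  using assms by simp_all

lemma complexify_mult_eq:
  "complexify K g x * complexify L h x = 
   complex_of_real (K (\<lambda>y. Re (g y)) x * L (\<lambda>y. Re (h y)) x - K (\<lambda>y. Im (g y)) x * L (\<lambda>y. Im (h y)) x) +
   \<i> * complex_of_real (K (\<lambda>y. Re (g y)) x * L (\<lambda>y. Im (h y)) x + K (\<lambda>y. Im (g y)) x * L (\<lambda>y. Re (h y)) x)"
  by (simp add: complexify_def complex_eq_iff)

text \<open>Lets a plain function be treated as a complexified operator, so that products with and
  without an operator in the first factor share one expansion.\<close>

lemma complexify_id: "complexify (\<lambda>f. f) h = h"
  by (simp add: complexify_def fun_eq_iff complex_eq_iff)

lemma integrable_complexify_mult:
  assumes "L2_operator M K" "L2_operator M L" "g \<in> L2 M" "h \<in> L2 M"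
  shows "integrable M (\<lambda>x. complexify K g x * complexify L h x)"
  unfolding complexify_mult_eq using L2_Re_Im[OF assms(3)] L2_Re_Im[OF assms(4)]
  by (intro complex_integrable_of_real_parts Bochner_Integration.integrable_diff
      Bochner_Integration.integrable_add L2_mult_integrable
      L2_operator_closed[OF assms(1)] L2_operator_closed[OF assms(2)])

lemma L2_operator_id: "L2_operator M (\<lambda>f. f)"
  by (auto simp: L2_operator_def intro: exI[of _ 1])

text \<open>Needed for \<open>K\<^sub>1\<^sup>*K\<^sub>1\<close>. The linearity of \<open>K\<close>
  holds almost everywhere only, so it is passed through \<open>L\<close> by the compatibility of
  \<open>L\<close> with almost-everywhere equality.\<close>

lemma L2_operator_comp:
  assumes K: "L2_operator M K" and L: "L2_operator M L"
  shows "L2_operator M (\<lambda>f. L (K f))"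
proof -
  have cl: "K f \<in> L2 M" "L f \<in> L2 M" if "f \<in> L2 M" for f
    using that K L by (auto intro: L2_operator_closed)
  have congL: "AE x in M. L f x = L g x" if "f \<in> L2 M" "g \<in> L2 M" "AE x in M. f x = g x" for f g
    using L that by (auto simp: L2_operator_def)
  show ?thesis
    unfolding L2_operator_def
  proof (intro conjI ballI allI impI)
    fix f g :: "'a \<Rightarrow> real" assume f: "f \<in> L2 M" and g: "g \<in> L2 M"
    show "L (K f) \<in> L2 M" using f by (intro cl)
    show "AE x in M. L (K f) x = L (K g) x" if "AE x in M. f x = g x"
      using that K f g by (intro congL cl) (auto simp: L2_operator_def)
    have "AE x in M. L (K (\<lambda>y. f y + g y)) x = L (\<lambda>y. K f y + K g y) x"
      using K f g by (intro congL cl L2_add) (auto simp: L2_operator_def)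
    moreover have "AE x in M. L (\<lambda>y. K f y + K g y) x = L (K f) x + L (K g) x"
      using L cl f g by (auto simp: L2_operator_def)
    ultimately show "AE x in M. L (K (\<lambda>y. f y + g y)) x = L (K f) x + L (K g) x"
      by eventually_elim simp
  next
    fix r and f :: "'a \<Rightarrow> real" assume f: "f \<in> L2 M"
    have "AE x in M. L (K (\<lambda>y. r * f y)) x = L (\<lambda>y. r * K f y) x"
      using K f by (intro congL cl L2_scale) (auto simp: L2_operator_def)
    moreover have "AE x in M. L (\<lambda>y. r * K f y) x = r * L (K f) x"
      using L cl f by (auto simp: L2_operator_def)
    ultimately show "AE x in M. L (K (\<lambda>y. r * f y)) x = r * L (K f) x"
      by eventually_elim simp
  next
    obtain C D where C: "\<And>f. f \<in> L2 M \<Longrightarrow> L2_norm M (K f) \<le> C * L2_norm M f"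
      and D: "\<And>f. f \<in> L2 M \<Longrightarrow> L2_norm M (L f) \<le> D * L2_norm M f"
      using K L unfolding L2_operator_def by metis
    have "L2_norm M (L (K f)) \<le> (\<bar>D\<bar> * C) * L2_norm M f" if f: "f \<in> L2 M" for f
    proof -
      have "L2_norm M (L (K f)) \<le> D * L2_norm M (K f)"
        using cl f by (intro D)
      also have "\<dots> \<le> \<bar>D\<bar> * L2_norm M (K f)"
        by (intro mult_right_mono L2_norm_nonneg) simp
      also have "\<dots> \<le> \<bar>D\<bar> * (C * L2_norm M f)"
        using C[OF f] by (intro mult_left_mono) auto
      finally show ?thesis by (simp add: mult_ac)
    qed
    then show "\<exists>E. \<forall>f\<in>L2 M. L2_norm M (L (K f)) \<le> E * L2_norm M f"
      by blast
  qed
qed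

text \<open>The multiplier is moved inside the first \<open>K\<close> by commutation, and then that
  \<open>K\<close> is moved to the other factor as its adjoint.\<close>

lemma integral_operator_mult:
  fixes K :: "(real^'d::finite \<Rightarrow> real) \<Rightarrow> (real^'d \<Rightarrow> real)"
  assumes K: "L2_operator lborel K" "commutes_with_multiplications c K"
    and \<psi>: "\<psi> \<in> borel_measurable borel" "bounded (range \<psi>)"
    and u: "u \<in> L2 lborel" and v: "v \<in> L2 lborel"
  shows "(LINT x|lborel. (K u x * K v x) * \<psi> (x $ c)) =
    (LINT x|lborel. (u x * L2_adjoint lborel K (K v) x) * \<psi> (x $ c))"
proof -
  obtain B where B: "\<And>r. \<bar>\<psi> r\<bar> \<le> B"
    using \<psi>(2) by (auto simp: bounded_iff)
  note [measurable] = \<psi>(1)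
  have \<psi>u: "(\<lambda>y. \<psi> (y $ c) * u y) \<in> L2 lborel"
    using B by (intro L2_mult_bounded[OF u]) auto
  have [measurable]: "K f \<in> borel_measurable borel" if "f \<in> L2 lborel" for f
    using L2_operator_closed[OF K(1) that] by (auto simp: L2_real)
  have [measurable]: "K u \<in> borel_measurable borel" "K v \<in> borel_measurable borel"
    "K (\<lambda>y. \<psi> (y $ c) * u y) \<in> borel_measurable borel"
    using u v \<psi>u by measurable
  have "AE x in lborel. K (\<lambda>y. \<psi> (y $ c) * u y) x = \<psi> (x $ c) * K u x"
    using K(2) \<psi> u by (auto simp: commutes_with_multiplications_def)
  then have "(LINT x|lborel. (K u x * K v x) * \<psi> (x $ c)) =
      (LINT x|lborel. K (\<lambda>y. \<psi> (y $ c) * u y) x * K v x)"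
    by (intro integral_cong_AE) (measurable, auto elim!: eventually_mono)
  also have "\<dots> = (LINT x|lborel. (\<psi> (x $ c) * u x) * L2_adjoint lborel K (K v) x)"
    using L2_adjoint[OF K(1)] \<psi>u L2_operator_closed[OF K(1) v] by (simp add: L2_is_adjoint_def)
  finally show ?thesis
    by (simp add: mult_ac)
qed

text \<open>Both sides expand by the same formula into real integrals with the real and imaginary
  parts of \<open>g\<close>, \<open>h\<close> and \<open>\<psi>\<close>, and these agree one by one
  by the real case.\<close>

lemma integral_complexify_operator_mult:
  fixes K :: "(real^'d::finite \<Rightarrow> real) \<Rightarrow> (real^'d \<Rightarrow> real)"
  assumes K: "L2_operator lborel K" "commutes_with_multiplications c K"
    and \<psi>: "\<psi> \<in> borel_measurable borel" "bounded (range \<psi>)"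
    and g: "g \<in> L2 lborel" and h: "h \<in> L2 lborel"
  shows "(LINT x|lborel. (complexify K g x * complexify K h x) * \<psi> (x $ c)) =
    (LINT x|lborel. (g x * complexify (\<lambda>f. L2_adjoint lborel K (K f)) h x) * \<psi> (x $ c))"
proof -
  define T where "T = (\<lambda>f. L2_adjoint lborel K (K f))"
  have adj: "L2_operator lborel (L2_adjoint lborel K)"
    using L2_adjoint[OF K(1)] by (simp add: L2_is_adjoint_def)
  have T: "L2_operator lborel T"
    unfolding T_def by (rule L2_operator_comp[OF K(1) adj])
  have \<psi>_parts: "(\<lambda>r. Re (\<psi> r)) \<in> borel_measurable borel" "bounded (range (\<lambda>r. Re (\<psi> r)))"
    "(\<lambda>r. Im (\<psi> r)) \<in> borel_measurable borel" "bounded (range (\<lambda>r. Im (\<psi> r)))"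
    using \<psi> by (auto simp: bounded_iff intro: order_trans[OF abs_Re_le_cmod] order_trans[OF abs_Im_le_cmod])
  have int: "integrable lborel (\<lambda>x. (u x * v x) * p (x $ c))"
    if asm: "u \<in> L2 lborel" "v \<in> L2 lborel" "p \<in> borel_measurable borel" "bounded (range p)"
    for u v :: "real^'d \<Rightarrow> real" and p :: "real \<Rightarrow> real"
  proof -
    obtain B where B: "\<And>r. \<bar>p r\<bar> \<le> B"
      using asm(4) by (auto simp: bounded_iff)
    note [measurable] = asm(3)
    have "(\<lambda>x. p (x $ c) * u x) \<in> L2 lborel"
      using B by (intro L2_mult_bounded[OF asm(1)]) auto
    from L2_mult_integrable[OF this asm(2)] show ?thesis
      by (simp add: mult_ac)
  qed
  \<comment> \<open>Stated for two operators, to be used for the pair \<open>K\<close>,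
    \<open>K\<close> and for the pair consisting of the identity and \<open>T\<close>.\<close>
  have expand: "(LINT x|lborel. (complexify L g x * complexify L' h x) * \<psi> (x $ c)) =
      complex_of_real (
        ((LINT x|lborel. (L (\<lambda>y. Re (g y)) x * L' (\<lambda>y. Re (h y)) x) * Re (\<psi> (x $ c))) -
         (LINT x|lborel. (L (\<lambda>y. Im (g y)) x * L' (\<lambda>y. Im (h y)) x) * Re (\<psi> (x $ c)))) -
        ((LINT x|lborel. (L (\<lambda>y. Re (g y)) x * L' (\<lambda>y. Im (h y)) x) * Im (\<psi> (x $ c))) +
         (LINT x|lborel. (L (\<lambda>y. Im (g y)) x * L' (\<lambda>y. Re (h y)) x) * Im (\<psi> (x $ c))))) +
      \<i> * complex_of_real (
        ((LINT x|lborel. (L (\<lambda>y. Re (g y)) x * L' (\<lambda>y. Re (h y)) x) * Im (\<psi> (x $ c))) -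
         (LINT x|lborel. (L (\<lambda>y. Im (g y)) x * L' (\<lambda>y. Im (h y)) x) * Im (\<psi> (x $ c)))) +
        ((LINT x|lborel. (L (\<lambda>y. Re (g y)) x * L' (\<lambda>y. Im (h y)) x) * Re (\<psi> (x $ c))) +
         (LINT x|lborel. (L (\<lambda>y. Im (g y)) x * L' (\<lambda>y. Re (h y)) x) * Re (\<psi> (x $ c)))))"
    if L: "L2_operator lborel L" "L2_operator lborel L'" for L L' :: "(real^'d \<Rightarrow> real) \<Rightarrow> (real^'d \<Rightarrow> real)"
  proof -
    define a b a' b' where ab: "a = L (\<lambda>y. Re (g y))" "b = L (\<lambda>y. Im (g y))"
      "a' = L' (\<lambda>y. Re (h y))" "b' = L' (\<lambda>y. Im (h y))"
    have [simp]: "a \<in> L2 lborel" "b \<in> L2 lborel" "a' \<in> L2 lborel" "b' \<in> L2 lborel"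
      unfolding ab using L g h by (auto intro: L2_operator_closed L2_Re_Im)
    have "(complexify L g x * complexify L' h x) * \<psi> (x $ c) =
      complex_of_real (
        ((a x * a' x) * Re (\<psi> (x $ c)) - (b x * b' x) * Re (\<psi> (x $ c))) -
        ((a x * b' x) * Im (\<psi> (x $ c)) + (b x * a' x) * Im (\<psi> (x $ c)))) +
      \<i> * complex_of_real (
        ((a x * a' x) * Im (\<psi> (x $ c)) - (b x * b' x) * Im (\<psi> (x $ c))) +
        ((a x * b' x) * Re (\<psi> (x $ c)) + (b x * a' x) * Re (\<psi> (x $ c))))" for x
      unfolding complexify_mult_eq ab[symmetric] by (simp add: complex_eq_iff algebra_simps)
    then show ?thesis
      unfolding ab[symmetric]
      by (simp only: complex_integrable_of_real_parts(2) int[OF _ _ \<psi>_parts(1,2)] int[OF _ _ \<psi>_parts(3,4)]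
          Bochner_Integration.integrable_diff Bochner_Integration.integrable_add
          Bochner_Integration.integral_diff Bochner_Integration.integral_add simp_thms
          \<open>a \<in> L2 lborel\<close> \<open>b \<in> L2 lborel\<close> \<open>a' \<in> L2 lborel\<close> \<open>b' \<in> L2 lborel\<close>)
  qed
  have *: "(LINT x|lborel. (K u x * K v x) * p (x $ c)) = (LINT x|lborel. (u x * T v x) * p (x $ c))"
    if "u \<in> L2 lborel" "v \<in> L2 lborel" "p \<in> borel_measurable borel" "bounded (range p)" for u v p
    unfolding T_def by (rule integral_operator_mult[OF K that(3,4,1,2)])
  have "(LINT x|lborel. (complexify K g x * complexify K h x) * \<psi> (x $ c)) =
      (LINT x|lborel. (complexify (\<lambda>f. f) g x * complexify T h x) * \<psi> (x $ c))"
    unfolding expand[OF K(1) K(1)] expand[OF L2_operator_id T]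
    by (simp only: *[OF _ _ \<psi>_parts(1,2)] *[OF _ _ \<psi>_parts(3,4)] L2_Re_Im[OF g] L2_Re_Im[OF h] \<psi>_parts)
  then show ?thesis
    by (simp add: complexify_id T_def)
qed

section \<open>The doubled space\<close>

lemma sigma_finite_Zm: "sigma_finite_measure (Zm :: 'd::finite doubled measure)"
proof -
  interpret pair_sigma_finite "count_space {1, 2::nat}" "lborel :: (real^'d) measure"
    by (rule pair_sigma_finite.intro, rule sigma_finite_measure_count_space_finite) (simp, rule lborel.sigma_finite_measure_axioms)
  show ?thesis
    unfolding Zm_def by (rule sigma_finite_measure_axioms)
qed

text \<open>By Fubini's theorem the integral over the doubled space is a sum over the two copies, of
  which the second contributes zero.\<close>

lemma first_copy_integral:
  fixes f :: "real^'d::finite \<Rightarrow> complex"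
  assumes "integrable lborel f"
  shows "integrable Zm (\<lambda>p. if fst p = 1 then f (snd p) else 0)"
    and "(LINT p|Zm. (if fst p = 1 then f (snd p) else 0)) = (LINT x|lborel. f x)"
proof -
  interpret pair_sigma_finite "count_space {1, 2::nat}" "lborel :: (real^'d) measure"
    by (rule pair_sigma_finite.intro, rule sigma_finite_measure_count_space_finite) (simp, rule lborel.sigma_finite_measure_axioms)
  note [measurable] = borel_measurable_integrable[OF assms]
  have "integrable (count_space {1, 2::nat} \<Otimes>\<^sub>M lborel) (\<lambda>p. if fst p = 1 then f (snd p) else 0)"
  proof (rule Fubini_integrable)
    show "(\<lambda>p. if fst p = 1 then f (snd p) else 0) \<in> borel_measurable (count_space {1, 2::nat} \<Otimes>\<^sub>M lborel)"
      by measurable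
    show "integrable (count_space {1, 2::nat}) (\<lambda>i. LINT x|lborel. norm (if fst (i, x) = 1 then f (snd (i, x)) else 0))"
      by (rule integrable_count_space) simp
    show "AE i in count_space {1, 2::nat}. integrable lborel (\<lambda>x. if fst (i, x) = 1 then f (snd (i, x)) else 0)"
    proof (intro AE_I2)
      fix i :: nat
      show "integrable lborel (\<lambda>x. if fst (i, x) = 1 then f (snd (i, x)) else 0)"
        using assms by (cases "i = 1") simp_all
    qed
  qed
  then show int: "integrable Zm (\<lambda>p. if fst p = 1 then f (snd p) else 0)"
    by (simp add: Zm_def)
  have "(LINT p|Zm. (if fst p = 1 then f (snd p) else 0)) =
      (LINT i|count_space {1, 2::nat}. LINT x|lborel. (if fst (i, x) = 1 then f (snd (i, x)) else 0))"
    unfolding Zm_def by (rule integral_fst'[symmetric, OF int[unfolded Zm_def]])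
  also have "\<dots> = (\<Sum>i\<in>{1, 2::nat}. LINT x|lborel. (if i = 1 then f x else 0))"
    by (simp only: lebesgue_integral_count_space_finite finite.intros fst_conv snd_conv)
  also have "\<dots> = (LINT x|lborel. f x)"
    by simp
  finally show "(LINT p|Zm. (if fst p = 1 then f (snd p) else 0)) = (LINT x|lborel. f x)" .
qed

section \<open>Vacuum expectations\<close>

lemma perm_factor_0: "perm_factor R 0 \<pi> x = 1"
proof -
  have "{(i, j). 1 \<le> i \<and> i < j \<and> j \<le> (0::nat) \<and> \<pi> i > \<pi> j} = {}"
    by auto
  then show ?thesis
    by (simp only: perm_factor_def prod.empty)
qed

lemma fock_vacuum_in_fock_fin: "fock_vacuum \<in> fock_fin M R"
proof -
  have "fock_vacuum n \<in> sym_functions M R n" for n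
    by (cases "n = 0") (auto simp: sym_functions_def fock_vacuum_def L2_def PiM_empty integrable_count_space)
  moreover have "summable (\<lambda>n. fact n * (L2_norm (PiM {1..n} (\<lambda>_. M)) (fock_vacuum n))\<^sup>2)"
    by (rule summable_finite[of "{0}"]) (auto simp: fock_vacuum_def L2_norm_def)
  ultimately show ?thesis
    by (auto simp: fock_fin_def fock_def fock_vacuum_def intro!: exI[of _ 0])
qed

text \<open>Only degree 0 contributes, and there the product space is the single point
  \<open>\<lambda>_. undefined\<close> with mass 1.\<close>

lemma fock_inner_vacuum: "fock_inner M f fock_vacuum = f 0 (\<lambda>_. undefined)"
proof -
  have "fock_inner M f fock_vacuum =
      (\<Sum>n\<in>{0}. fact n * (LINT x|PiM {1..n} (\<lambda>_. M). f n x * cnj (fock_vacuum n x)))"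
    unfolding fock_inner_def by (rule suminf_finite) (auto simp: fock_vacuum_def)
  then show ?thesis
    by (simp add: fock_vacuum_def PiM_empty lebesgue_integral_count_space_finite)
qed

lemma history_integral_zero: "history_integral M R k g \<kappa> n H (\<lambda>_. 0) x = 0"
  by (simp add: history_integral_def)

text \<open>The vacuum vanishes in positive degrees, and in degree 0 the projection is the identity.
  What remains are the histories leading from the empty word back to it.\<close>

lemma operator_integral_vacuum:
  "operator_integral M R k sg g \<kappa> fock_vacuum 0 x =
    (\<Sum>H\<leftarrow>filter (\<lambda>H. word H = []) (histories sg k 0 k). history_integral M R k g \<kappa> 0 H (\<lambda>_. 1) x)"
proof -
  have "operator_integral M R k sg g \<kappa> fock_vacuum 0 x =
      (\<Sum>n\<le>k. \<Sum>H\<leftarrow>filter (\<lambda>H. word H = []) (histories sg k n k).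
         history_integral M R k g \<kappa> n H (fock_vacuum n) x)"
    by (simp add: operator_integral_def fock_vacuum_in_fock_fin fock_proj_def perm_factor_0)
  also have "\<dots> = (\<Sum>n\<in>{0}. \<Sum>H\<leftarrow>filter (\<lambda>H. word H = []) (histories sg k n k).
         history_integral M R k g \<kappa> n H (fock_vacuum n) x)"
    by (rule sum.mono_neutral_right) (auto simp: fock_vacuum_def history_integral_zero)
  finally show ?thesis
    by (simp add: fock_vacuum_def)
qed

section \<open>Permutation factors\<close>

text \<open>The kernel and the space of its arguments may both change; this serves to pass between
  \<open>JQ Q\<close>, \<open>Q\<close> and the kernel \<open>q\<close> of two real
  variables.\<close>

lemma perm_factor_cong:
  assumes "\<And>i j. i \<in> {1..n} \<Longrightarrow> j \<in> {1..n} \<Longrightarrow> R (x i) (x j) = R' (y i) (y j)"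
  shows "perm_factor R n \<pi> x = perm_factor R' n \<pi> y"
  unfolding perm_factor_def using assms by (intro prod.cong) auto

lemma norm_perm_factor_le:
  assumes "\<And>s t. norm (R s t) \<le> B"
  shows "norm (perm_factor R n \<pi> x) \<le> B ^ card {(i, j). 1 \<le> i \<and> i < j \<and> j \<le> n \<and> \<pi> i > \<pi> j}"
proof -
  have "norm (perm_factor R n \<pi> x) \<le>
      (\<Prod>p\<in>{(i, j). 1 \<le> i \<and> i < j \<and> j \<le> n \<and> \<pi> i > \<pi> j}. norm (case p of (i, j) \<Rightarrow> R (x i) (x j)))"
    unfolding perm_factor_def by (rule norm_prod_le)
  also have "\<dots> \<le> (\<Prod>p\<in>{(i, j). 1 \<le> i \<and> i < j \<and> j \<le> n \<and> \<pi> i > \<pi> j}. B)"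
    by (rule prod_mono) (auto simp: assms)
  finally show ?thesis
    by simp
qed

lemma measurable_perm_factor:
  fixes R :: "real \<Rightarrow> real \<Rightarrow> complex"
  assumes "(\<lambda>(s, t). R s t) \<in> borel_measurable borel"
  shows "perm_factor R n \<pi> \<in> borel_measurable (PiM {1..n} (\<lambda>_. borel))"
proof -
  have [measurable]: "(\<lambda>p. R (fst p) (snd p)) \<in> borel_measurable (borel \<Otimes>\<^sub>M borel)"
    using assms by (simp add: borel_prod case_prod_beta')
  have "(\<lambda>x. R (x i) (x j)) \<in> borel_measurable (PiM {1..n} (\<lambda>_. borel))"
    if "i \<in> {1..n}" "j \<in> {1..n}" for i j
  proof -
    have "(\<lambda>x. (x i, x j)) \<in> PiM {1..n} (\<lambda>_. borel) \<rightarrow>\<^sub>M borel \<Otimes>\<^sub>M (borel :: real measure)"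
      using that by (intro measurable_Pair measurable_component_singleton)
    from measurable_compose[OF this, of "\<lambda>p. R (fst p) (snd p)"] show ?thesis
      by simp
  qed
  then show ?thesis
    unfolding perm_factor_def[abs_def] by (intro borel_measurable_prod) auto
qed

text \<open>A function of the \<open>c\<close>-th coordinates is recovered from its values at
  constant vectors, and these depend continuously on the coordinate, which preserves
  measurability.\<close>

lemma exchange_function_coordinate:
  assumes "exchange_function c \<eta> Q"
  obtains q B where "(\<lambda>(s, t). q s t) \<in> borel_measurable borel" "\<And>s t :: real. norm (q s t) \<le> B"
    "\<And>x y. Q x y = q (x $ c) (y $ c)"
proof
  have Qm: "(\<lambda>(x, y). Q x y) \<in> borel_measurable borel"
    and Q_cong: "\<And>x y x' y'. x $ c = x' $ c \<Longrightarrow> y $ c = y' $ c \<Longrightarrow> Q x y = Q x' y'"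
    and Q_off: "\<And>x y. x $ c \<noteq> y $ c \<Longrightarrow> norm (Q x y) = 1"
    and Q_diag: "\<And>x y. x $ c = y $ c \<Longrightarrow> Q x y = complex_of_real \<eta>"
    using assms unfolding exchange_function_def by blast+
  define e :: "real \<Rightarrow> real^'a" where "e s = (\<chi> _. s)" for s
  define q where "q s t = Q (e s) (e t)" for s t
  have "(\<lambda>p. (e (fst p), e (snd p))) \<in> borel_measurable borel"
    unfolding e_def
    by (intro borel_measurable_continuous_onI continuous_on_Pair continuous_on_vec_lambda
        continuous_on_fst continuous_on_snd continuous_on_id)
  from measurable_compose[OF this Qm] have "(\<lambda>p. (\<lambda>(x, y). Q x y) (e (fst p), e (snd p))) \<in> borel_measurable borel"
    .
  then show "(\<lambda>(s, t). q s t) \<in> borel_measurable borel"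
    by (simp add: q_def case_prod_beta')
  show "Q x y = q (x $ c) (y $ c)" for x y
    unfolding q_def by (rule Q_cong) (simp_all add: e_def)
  \<comment> \<open>The modulus is 1 off the diagonal and \<open>\<bar>\<eta>\<bar>\<close> on
    it.\<close>
  show "norm (q s t) \<le> max 1 \<bar>\<eta>\<bar>" for s t
    using Q_off[of "e s" "e t"] Q_diag[of "e s" "e t"] by (cases "s = t") (simp_all add: q_def e_def)
qed

section \<open>Recorded factors and inversions\<close>

lemma prod_list_concat_map:
  fixes f :: "'a \<Rightarrow> 'b::comm_monoid_mult"
  shows "prod_list (map f (concat (map G xs))) = (\<Prod>x\<leftarrow>xs. \<Prod>y\<leftarrow>G x. f y)"
  by (induction xs) simp_all

lemma prod_list_filter_upt:
  "(\<Prod>p\<leftarrow>filter P [a..<b]. f p) = (\<Prod>p\<in>{p \<in> {a..<b}. P p}. f p :: 'a::comm_monoid_mult)"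
  using prod.distinct_set_conv_list[of "filter P [a..<b]" f] by (simp add: conj_commute)

text \<open>At the \<open>i\<close>-th deletion the letters in front are those with numbers
  \<open>p < \<pi> i\<close> not yet deleted. As \<open>\<pi>\<close> is onto, they are
  \<open>p = \<pi> j\<close> with \<open>j > i\<close> and \<open>\<pi> j < \<pi> i\<close>, so the
  recorded factors run over the inversions of \<open>\<pi>\<close>.\<close>

lemma deletion_history_factors:
  assumes \<pi>: "\<pi> permutes {1..n}"
  shows "prod_list (map (\<lambda>(z, u). R (\<omega> z) (\<omega> u)) (factors (deletion_history n n \<pi>))) =
    perm_factor R n \<pi> (\<lambda>i. \<omega> (Created (n + \<pi> i)))"
proof -
  have "prod_list (map (\<lambda>(z, u). R (\<omega> z) (\<omega> u)) (factors (deletion_history n n \<pi>))) =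
      (\<Prod>i\<leftarrow>[1..<Suc n]. \<Prod>p\<leftarrow>filter (\<lambda>p. p < \<pi> i \<and> p \<notin> \<pi> ` {1..i}) [1..<Suc n].
         R (\<omega> (Created (n + \<pi> i))) (\<omega> (Created (n + p))))"
    by (simp add: deletion_history_def prod_list_concat_map comp_def del: upt_Suc)
  also have "\<dots> = (\<Prod>i\<in>{1..n}. \<Prod>p | p \<in> {1..n} \<and> p < \<pi> i \<and> p \<notin> \<pi> ` {1..i}.
         R (\<omega> (Created (n + \<pi> i))) (\<omega> (Created (n + p))))"
  proof -
    have "(\<Prod>i\<leftarrow>[1..<Suc n]. f i) = (\<Prod>i\<in>{1..n}. f i)" for f :: "nat \<Rightarrow> complex"
      using prod.distinct_set_conv_list[of "[1..<Suc n]" f]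
      by (simp add: atLeastLessThanSuc_atLeastAtMost del: upt_Suc)
    then show ?thesis
      by (simp only: prod_list_filter_upt atLeastLessThanSuc_atLeastAtMost)
  qed
  also have "\<dots> = (\<Prod>i\<in>{1..n}. \<Prod>j | j \<in> {i<..n} \<and> \<pi> j < \<pi> i.
         R (\<omega> (Created (n + \<pi> i))) (\<omega> (Created (n + \<pi> j))))"
  proof (rule prod.cong[OF refl])
    fix i assume i: "i \<in> {1..n}"
    have "{p. p \<in> {1..n} \<and> p < \<pi> i \<and> p \<notin> \<pi> ` {1..i}} = \<pi> ` {j. j \<in> {i<..n} \<and> \<pi> j < \<pi> i}"
    proof (intro equalityI subsetI)
      fix p assume "p \<in> {p. p \<in> {1..n} \<and> p < \<pi> i \<and> p \<notin> \<pi> ` {1..i}}"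
      then have p: "p \<in> \<pi> ` {1..n}" "p < \<pi> i" "p \<notin> \<pi> ` {1..i}"
        using permutes_image[OF \<pi>] by auto
      then obtain j where "j \<in> {1..n}" "p = \<pi> j" by blast
      then show "p \<in> \<pi> ` {j. j \<in> {i<..n} \<and> \<pi> j < \<pi> i}"
        using p by (intro image_eqI[of _ _ j]) (auto simp: not_le[symmetric])
    next
      fix p assume "p \<in> \<pi> ` {j. j \<in> {i<..n} \<and> \<pi> j < \<pi> i}"
      then obtain j where j: "p = \<pi> j" "j \<in> {i<..n}" "\<pi> j < \<pi> i" by blast
      have "\<pi> j \<in> {1..n}"
        using j i permutes_in_image[OF \<pi>, of j] by simp
      moreover have "\<pi> j \<notin> \<pi> ` {1..i}"
        using j(2) inj_image_mem_iff[OF permutes_inj[OF \<pi>], of j "{1..i}"] by simp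
      ultimately show "p \<in> {p. p \<in> {1..n} \<and> p < \<pi> i \<and> p \<notin> \<pi> ` {1..i}}"
        using j by simp
    qed
    then show "(\<Prod>p | p \<in> {1..n} \<and> p < \<pi> i \<and> p \<notin> \<pi> ` {1..i}. R (\<omega> (Created (n + \<pi> i))) (\<omega> (Created (n + p)))) =
        (\<Prod>j | j \<in> {i<..n} \<and> \<pi> j < \<pi> i. R (\<omega> (Created (n + \<pi> i))) (\<omega> (Created (n + \<pi> j))))"
      using permutes_inj_on[OF \<pi>] by (simp only: prod.reindex comp_def)
  qed
  also have "\<dots> = (\<Prod>(i, j)\<in>(SIGMA i:{1..n}. {j. j \<in> {i<..n} \<and> \<pi> j < \<pi> i}).
         R (\<omega> (Created (n + \<pi> i))) (\<omega> (Created (n + \<pi> j))))"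
    by (rule prod.Sigma) auto
  also have "(SIGMA i:{1..n}. {j. j \<in> {i<..n} \<and> \<pi> j < \<pi> i}) =
      {(i, j). 1 \<le> i \<and> i < j \<and> j \<le> n \<and> \<pi> i > \<pi> j}"
    by auto
  finally show ?thesis
    by (simp add: perm_factor_def)
qed

section \<open>Integrals of complete histories\<close>

lemma deletion_history_complete:
  assumes "\<pi> permutes {1..n}"
  shows "word (deletion_history n n \<pi>) = []"
  using permutes_image[OF assms] by (auto simp: deletion_history_def filter_empty_conv)

lemma deletion_history_yvar:
  assumes "\<pi> permutes {1..n}" "i \<in> {1..n}"
  shows "yvar (deletion_history n n \<pi>) (Suc n - i) = Created (n + \<pi> i)"
    and "yvar (deletion_history n n \<pi>) (n + \<pi> i) = Created (n + \<pi> i)"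
  using permutes_in_image[OF assms(1), of i] assms(2) by (auto simp: deletion_history_def)

text \<open>Groups the steps into pairs: step \<open>Suc n - i\<close> deletes the letter created at
  step \<open>n + \<pi> i\<close>.\<close>

lemma prod_pairing:
  fixes f :: "nat \<Rightarrow> 'a::comm_monoid_mult"
  assumes \<pi>: "\<pi> permutes {1..n}"
  shows "(\<Prod>j=1..2 * n. f j) = (\<Prod>i=1..n. f (Suc n - i) * f (n + \<pi> i))"
proof -
  have "{1..2 * n} = {1..n} \<union> {n<..2 * n}" "{1..n} \<inter> {n<..2 * n} = {}" by auto
  then have "(\<Prod>j=1..2 * n. f j) = (\<Prod>j=1..n. f j) * (\<Prod>j\<in>{n<..2 * n}. f j)"
    by (simp only: prod.union_disjoint finite_atLeastAtMost finite_greaterThanAtMost)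
  also have "(\<Prod>j=1..n. f j) = (\<Prod>i=1..n. f (Suc n - i))"
    by (rule prod.reindex_bij_witness[where i = "\<lambda>i. Suc n - i" and j = "\<lambda>i. Suc n - i"]) auto
  also have "(\<Prod>j\<in>{n<..2 * n}. f j) = (\<Prod>p=1..n. f (n + p))"
    by (rule prod.reindex_bij_witness[where i = "\<lambda>p. n + p" and j = "\<lambda>j. j - n"]) auto
  also have "\<dots> = (\<Prod>i=1..n. f (n + \<pi> i))"
    using prod.permute[OF \<pi>, of "\<lambda>p. f (n + p)"] by (simp add: comp_def)
  finally show ?thesis
    by (simp add: prod.distrib)
qed

text \<open>The final word is empty, so every letter is an integration variable evaluated by
  \<open>\<omega>\<close>. The two steps of a pair share a letter, which leaves \<open>n\<close>
  variables for the \<open>2 * n\<close> functions.\<close>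

lemma history_integral_deletion:
  assumes \<pi>: "\<pi> permutes {1..n}"
  shows "history_integral M R (2 * n) g \<kappa> 0 (deletion_history n n \<pi>) (\<lambda>_. 1) x =
    (LINT \<omega>|PiM ((\<lambda>i. Created (n + \<pi> i)) ` {1..n}) (\<lambda>_. M).
       (\<Prod>i=1..n. g (Suc n - i) (\<omega> (Created (n + \<pi> i))) * g (n + \<pi> i) (\<omega> (Created (n + \<pi> i)))) *
       \<kappa> (\<lambda>j\<in>{1..2 * n}. \<omega> (yvar (deletion_history n n \<pi>) j)) *
       perm_factor R n \<pi> (\<lambda>i. \<omega> (Created (n + \<pi> i))))"
proof -
  have "deleted (deletion_history n n \<pi>) = (\<lambda>i. Created (n + \<pi> i)) ` {1..n}"
    by (simp add: deletion_history_def)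
  moreover have "(\<Prod>j=1..2 * n. g j ((\<lambda>j\<in>{1..2 * n}. \<omega> (yvar (deletion_history n n \<pi>) j)) j)) =
      (\<Prod>i=1..n. g (Suc n - i) (\<omega> (Created (n + \<pi> i))) * g (n + \<pi> i) (\<omega> (Created (n + \<pi> i))))" for \<omega>
  proof -
    have "(\<Prod>j=1..2 * n. g j ((\<lambda>j\<in>{1..2 * n}. \<omega> (yvar (deletion_history n n \<pi>) j)) j)) =
        (\<Prod>j=1..2 * n. g j (\<omega> (yvar (deletion_history n n \<pi>) j)))"
      by (intro prod.cong) auto
    also have "\<dots> = (\<Prod>i=1..n. g (Suc n - i) (\<omega> (yvar (deletion_history n n \<pi>) (Suc n - i))) *
        g (n + \<pi> i) (\<omega> (yvar (deletion_history n n \<pi>) (n + \<pi> i))))"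
      by (rule prod_pairing[OF \<pi>])
    also have "\<dots> = (\<Prod>i=1..n. g (Suc n - i) (\<omega> (Created (n + \<pi> i))) * g (n + \<pi> i) (\<omega> (Created (n + \<pi> i))))"
      by (intro prod.cong refl) (simp only: deletion_history_yvar[OF \<pi>])
    finally show ?thesis .
  qed
  ultimately show ?thesis
    by (simp only: history_integral_def deletion_history_complete[OF \<pi>] Let_def list.size zip_Nil map_of.simps option.case
        deletion_history_factors[OF \<pi>] mult_1_right)
qed

text \<open>A creation step in copy 1 lies in the second half of the steps and in copy 2 in the first
  half, annihilations the other way round. As a letter is created before it is deleted, both
  members of a pair can only lie in the same copy if it is copy 1.\<close>

lemma mixed_copies_vanish:
  assumes i: "i \<in> {1..2 * n} \<rightarrow>\<^sub>E {1, 2}" "i \<noteq> (\<lambda>j\<in>{1..2 * n}. 1)"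
    and H: "H \<in> set (histories (\<lambda>j. copy_sign (i j) (if j \<le> n then Plus else Minus)) (2 * n) 0 (2 * n))"
      "word H = []"
  shows "history_integral M R (2 * n) (\<lambda>j. copy_embed K1 K2 (i j) (f j)) \<kappa> 0 H (\<lambda>_. 1) x = 0"
proof -
  define sg where "sg j = copy_sign (i j) (if j \<le> n then Plus else Minus)" for j
  have "\<exists>j\<in>{1..2 * n}. i j \<noteq> 1"
  proof (rule ccontr)
    assume "\<not> (\<exists>j\<in>{1..2 * n}. i j \<noteq> 1)"
    then have "i = (\<lambda>j\<in>{1..2 * n}. 1)"
      by (intro PiE_ext[OF i(1)]) auto
    with i(2) show False ..
  qed
  then obtain j where j: "j \<in> {1..2 * n}" "i j = 2"
    using i(1) by auto
  \<comment> \<open>Since the final word is empty, a created letter cannot have survived and must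
    have been deleted.\<close>
  have pairing: "sg j = Plus \<longrightarrow> (\<exists>j'\<in>{0<..<j}. sg j' = Minus \<and> yvar H j' = yvar H j)"
    "sg j = Minus \<longrightarrow> (\<exists>j'\<in>{j<..2 * n}. sg j' = Plus \<and> yvar H j' = yvar H j)"
    using histories_pairing[OF H(1)[folded sg_def] order_refl] H(2) j(1) by force+
  obtain j' where j': "j' \<in> {1..2 * n}" "i j' = 1" "yvar H j' = yvar H j"
  proof (cases "j \<le> n")
    \<comment> \<open>In copy 2 such a step creates. Its letter is deleted at some
      \<open>j' < j\<close>, again in the first half, where only copy 1 deletes.\<close>
    case True
    then obtain j' where "j' \<in> {0<..<j}" "sg j' = Minus" "yvar H j' = yvar H j"
      using pairing j by (auto simp: sg_def)
    then show thesis
      using True by (intro that[of j']) (auto simp: sg_def split: if_splits)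
  next
    case False
    then obtain j' where "j' \<in> {j<..2 * n}" "sg j' = Plus" "yvar H j' = yvar H j"
      using pairing j by (auto simp: sg_def)
    then show thesis
      using False by (intro that[of j']) (auto simp: sg_def split: if_splits)
  qed
  \<comment> \<open>The two steps evaluate at the same point of the doubled space, which cannot lie
    in both copies, so one of the two factors is zero.\<close>
  have "(\<Prod>l=1..2 * n. copy_embed K1 K2 (i l) (f l) ((\<lambda>j\<in>{1..2 * n}. e (yvar H j)) l)) = 0" for e
  proof (cases "fst (e (yvar H j)) = 1")
    case True
    then show ?thesis
      using j by (intro prod_zero bexI[of _ j]) (auto simp: copy_embed_def)
  next
    case False
    then show ?thesis
      using j j' by (intro prod_zero bexI[of _ j']) (auto simp: copy_embed_def)
  qed
  then show ?thesis
    by (simp only: history_integral_def Let_def mult_zero_left Bochner_Integration.integral_zero)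
qed

text \<open>Of all assignments of copies only the one using copy 1 throughout survives. It exchanges
  the signs, so that the second half of the steps, carried out first, creates and the first half
  deletes.\<close>

lemma vacuum_expectation_permutations:
  fixes f :: "nat \<Rightarrow> real^'d::finite \<Rightarrow> complex"
  shows "gen_operator c Q K1 K2 (2 * n) (\<lambda>j. if j \<le> n then Plus else Minus) f v fock_vacuum 0 x =
    (\<Sum>\<pi> | \<pi> permutes {1..n}. LINT \<omega>|PiM ((\<lambda>i. Created (n + \<pi> i)) ` {1..n}) (\<lambda>_. Zm).
       (\<Prod>i=1..n. copy_embed K1 K2 1 (f (Suc n - i)) (\<omega> (Created (n + \<pi> i))) *
          copy_embed K1 K2 1 (f (n + \<pi> i)) (\<omega> (Created (n + \<pi> i)))) *
       copy_lift c (2 * n) (\<lambda>j\<in>{1..2 * n}. 1) v (\<lambda>j\<in>{1..2 * n}. \<omega> (yvar (deletion_history n n \<pi>) j)) *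
       perm_factor (JQ Q) n \<pi> (\<lambda>i. \<omega> (Created (n + \<pi> i))))"
proof -
  define one :: "nat \<Rightarrow> nat" where "one = (\<lambda>j\<in>{1..2 * n}. 1)"
  define sg where "sg i j = copy_sign (i j) (if j \<le> n then Plus else Minus)" for i j
  define E where "E i j = copy_embed K1 K2 (i j) (f j)" for i :: "nat \<Rightarrow> nat" and j
  define V where "V i = operator_integral Zm (JQ Q) (2 * n) (sg i) (E i) (copy_lift c (2 * n) i v) fock_vacuum 0 x" for i
  have "gen_operator c Q K1 K2 (2 * n) (\<lambda>j. if j \<le> n then Plus else Minus) f v fock_vacuum 0 x =
      (\<Sum>i\<in>{1..2 * n} \<rightarrow>\<^sub>E {1, 2}. V i)"
    by (simp add: gen_operator_def fock_vacuum_in_fock_fin V_def sg_def[abs_def] E_def[abs_def])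
  also have "\<dots> = (\<Sum>i\<in>{one}. V i)"
  proof (rule sum.mono_neutral_right)
    show "\<forall>i\<in>({1..2 * n} \<rightarrow>\<^sub>E {1, 2}) - {one}. V i = 0"
    proof
      fix i assume "i \<in> ({1..2 * n} \<rightarrow>\<^sub>E {1, 2}) - {one}"
      then have i: "i \<in> {1..2 * n} \<rightarrow>\<^sub>E {1, 2}" "i \<noteq> (\<lambda>j\<in>{1..2 * n}. 1)"
        by (auto simp: one_def)
      have *: "(\<Sum>H\<leftarrow>Hs. F H) = 0" if "\<And>H. H \<in> set Hs \<Longrightarrow> F H = 0"
        for F :: "history \<Rightarrow> complex" and Hs
        using that by (induction Hs) simp_all
      show "V i = 0"
        unfolding V_def operator_integral_vacuum E_def[abs_def] sg_def[abs_def]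
        by (rule *, rule mixed_copies_vanish[OF i]) simp_all
    qed
  qed (auto simp: one_def intro: finite_PiE)
  \<comment> \<open>The filter becomes a conditional, so that the sum runs over all histories; those
    attached to permutations all pass the test.\<close>
  also have "\<dots> = (\<Sum>H\<leftarrow>histories (sg one) (2 * n) 0 (2 * n). if word H = [] then
      history_integral Zm (JQ Q) (2 * n) (E one) (copy_lift c (2 * n) one v) 0 H (\<lambda>_. 1) x else 0)"
    by (simp add: V_def operator_integral_vacuum sum_list_map_filter')
  also have "\<dots> = (\<Sum>\<pi> | \<pi> permutes {1..n}. if word (deletion_history n n \<pi>) = [] then
      history_integral Zm (JQ Q) (2 * n) (E one) (copy_lift c (2 * n) one v) 0 (deletion_history n n \<pi>) (\<lambda>_. 1) x else 0)"
    by (rule sum_histories_permutations) (auto simp: sg_def one_def)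
  also have "\<dots> = (\<Sum>\<pi> | \<pi> permutes {1..n}. LINT \<omega>|PiM ((\<lambda>i. Created (n + \<pi> i)) ` {1..n}) (\<lambda>_. Zm).
       (\<Prod>i=1..n. copy_embed K1 K2 1 (f (Suc n - i)) (\<omega> (Created (n + \<pi> i))) *
          copy_embed K1 K2 1 (f (n + \<pi> i)) (\<omega> (Created (n + \<pi> i)))) *
       copy_lift c (2 * n) one v (\<lambda>j\<in>{1..2 * n}. \<omega> (yvar (deletion_history n n \<pi>) j)) *
       perm_factor (JQ Q) n \<pi> (\<lambda>i. \<omega> (Created (n + \<pi> i))))"
  proof (intro sum.cong refl)
    fix \<pi> assume "\<pi> \<in> {\<pi>. \<pi> permutes {1..n}}"
    then have \<pi>: "\<pi> permutes {1..n}" by simp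
    have E: "E one (Suc n - i) = copy_embed K1 K2 1 (f (Suc n - i))"
        "E one (n + \<pi> i) = copy_embed K1 K2 1 (f (n + \<pi> i))" if "i \<in> {1..n}" for i
      using that permutes_in_image[OF \<pi>, of i] by (auto simp: E_def one_def fun_eq_iff)
    show "(if word (deletion_history n n \<pi>) = [] then
      history_integral Zm (JQ Q) (2 * n) (E one) (copy_lift c (2 * n) one v) 0 (deletion_history n n \<pi>) (\<lambda>_. 1) x else 0) =
      (LINT \<omega>|PiM ((\<lambda>i. Created (n + \<pi> i)) ` {1..n}) (\<lambda>_. Zm).
       (\<Prod>i=1..n. copy_embed K1 K2 1 (f (Suc n - i)) (\<omega> (Created (n + \<pi> i))) *
          copy_embed K1 K2 1 (f (n + \<pi> i)) (\<omega> (Created (n + \<pi> i)))) *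
       copy_lift c (2 * n) one v (\<lambda>j\<in>{1..2 * n}. \<omega> (yvar (deletion_history n n \<pi>) j)) *
       perm_factor (JQ Q) n \<pi> (\<lambda>i. \<omega> (Created (n + \<pi> i))))"
      by (simp only: deletion_history_complete[OF \<pi>] history_integral_deletion[OF \<pi>] E simp_thms if_True
          cong: prod.cong)
  qed
  finally show ?thesis
    by (simp only: one_def)
qed

text \<open>An instance of \<open>integral_PiM_transfer\<close> from the doubled space to
  \<open>lborel\<close>, both maps to the parameter space being the first coordinate. It removes the
  second copy and replaces the products of \<open>K\<^sub>1\<close> images by products with
  \<open>T\<close> in one stroke.\<close>

lemma integral_deletion_history:
  fixes g h :: "nat \<Rightarrow> real^'d::finite \<Rightarrow> complex"
  assumes Q: "exchange_function c \<eta> Q"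
    and K1: "L2_operator lborel K1" "commutes_with_multiplications c K1"
    and g: "\<And>i. i \<in> {1..n} \<Longrightarrow> g i \<in> L2 lborel" and h: "\<And>i. i \<in> {1..n} \<Longrightarrow> h i \<in> L2 lborel"
    and \<pi>: "\<pi> permutes {1..n}"
  shows "(LINT \<omega>|PiM ((\<lambda>i. Created (n + \<pi> i)) ` {1..n}) (\<lambda>_. Zm).
       (\<Prod>i=1..n. copy_embed K1 K2 1 (g i) (\<omega> (Created (n + \<pi> i))) *
          copy_embed K1 K2 1 (h (\<pi> i)) (\<omega> (Created (n + \<pi> i)))) *
       copy_lift c (2 * n) (\<lambda>j\<in>{1..2 * n}. 1) (\<lambda>_. 1) (\<lambda>j\<in>{1..2 * n}. \<omega> (yvar (deletion_history n n \<pi>) j)) *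
       perm_factor (JQ Q) n \<pi> (\<lambda>i. \<omega> (Created (n + \<pi> i)))) =
    (LINT x|PiM {1..n} (\<lambda>_. lborel).
         (\<Prod>i=1..n. g i (x i) * complexify (\<lambda>f. L2_adjoint lborel K1 (K1 f)) (h (\<pi> i)) (x i))
         * perm_factor Q n \<pi> x)"
proof -
  obtain q B where q: "(\<lambda>(s, t). q s t) \<in> borel_measurable borel" "\<And>s t :: real. norm (q s t) \<le> B"
    and Qq: "\<And>x y. Q x y = q (x $ c) (y $ c)"
    using exchange_function_coordinate[OF Q] by metis
  define \<phi> where "\<phi> i = Created (n + \<pi> i)" for i
  define T where "T = (\<lambda>f. L2_adjoint lborel K1 (K1 f))"
  \<comment> \<open>The paired functions of one letter, with the restriction to the first copy built
    in.\<close>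
  define a where "a i p = (if fst p = 1 then complexify K1 (g i) (snd p) * complexify K1 (h (\<pi> i)) (snd p) else 0)"
    for i and p :: "'d doubled"
  define b where "b i x = g i x * complexify T (h (\<pi> i)) x" for i x
  have h\<pi>: "h (\<pi> i) \<in> L2 lborel" if "i \<in> {1..n}" for i
    using h permutes_in_image[OF \<pi>] that by blast
  have T: "L2_operator lborel T"
    unfolding T_def by (rule L2_operator_comp[OF K1(1)]) (use L2_adjoint[OF K1(1)] in \<open>simp add: L2_is_adjoint_def\<close>)
  have s: "(\<lambda>p. snd p $ c) \<in> Zm \<rightarrow>\<^sub>M borel" "(\<lambda>x. x $ c) \<in> lborel \<rightarrow>\<^sub>M borel"
    unfolding Zm_def
    by (auto intro!: measurable_compose[OF measurable_snd] borel_measurable_continuous_onI continuous_on_component)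
  have int_a: "integrable Zm (a i)" if "i \<in> {1..n}" for i
    unfolding a_def
    by (rule first_copy_integral(1)[OF integrable_complexify_mult[OF K1(1) K1(1) g[OF that] h\<pi>[OF that]]])
  have int_b: "integrable lborel (b i)" if "i \<in> {1..n}" for i
    using integrable_complexify_mult[OF L2_operator_id T g[OF that] h\<pi>[OF that]]
    by (simp add: b_def[abs_def] complexify_id)
  have ab: "(LINT p|Zm. a i p * \<psi> (snd p $ c)) = (LINT x|lborel. b i x * \<psi> (x $ c))"
    if i: "i \<in> {1..n}" and \<psi>: "\<psi> \<in> borel_measurable borel" "bounded (range \<psi>)" for i \<psi>
  proof -
    obtain C where C: "\<And>r. norm (\<psi> r) \<le> C"
      using \<psi>(2) by (auto simp: bounded_iff)
    define k where "k x = complexify K1 (g i) x * complexify K1 (h (\<pi> i)) x" for x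
    have k: "integrable lborel k"
      unfolding k_def by (rule integrable_complexify_mult[OF K1(1) K1(1) g[OF i] h\<pi>[OF i]])
    have int: "integrable lborel (\<lambda>x. k x * \<psi> (x $ c))"
    proof (rule Bochner_Integration.integrable_bound)
      show "integrable lborel (\<lambda>x. complex_of_real C * k x)"
        using k by simp
      show "(\<lambda>x. k x * \<psi> (x $ c)) \<in> borel_measurable lborel"
        using borel_measurable_integrable[OF k] measurable_compose[OF s(2) \<psi>(1)] by simp
      have "norm (k x * \<psi> (x $ c)) \<le> norm (complex_of_real C * k x)" for x
        using mult_right_mono[OF order_trans[OF C abs_ge_self], of "norm (k x)" "x $ c"]
        by (simp add: norm_mult mult.commute)
      then show "AE x in lborel. norm (k x * \<psi> (x $ c)) \<le> norm (complex_of_real C * k x)"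
        by simp
    qed
    have "a i p * \<psi> (snd p $ c) = (if fst p = 1 then k (snd p) * \<psi> (snd p $ c) else 0)" for p
      by (simp add: a_def k_def)
    then have "(LINT p|Zm. a i p * \<psi> (snd p $ c)) = (LINT x|lborel. k x * \<psi> (x $ c))"
      using first_copy_integral(2)[OF int] by (simp only:)
    also have "\<dots> = (LINT x|lborel. b i x * \<psi> (x $ c))"
      unfolding k_def b_def T_def by (rule integral_complexify_operator_mult[OF K1 \<psi> g[OF i] h\<pi>[OF i]])
    finally show ?thesis .
  qed
  have "inj_on \<phi> {1..n}"
    using permutes_inj_on[OF \<pi>] by (auto simp: \<phi>_def inj_on_def)
  then have transfer: "(LINT \<omega>|PiM (\<phi> ` {1..n}) (\<lambda>_. Zm). (\<Prod>i\<in>{1..n}. a i (\<omega> (\<phi> i))) *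
        perm_factor q n \<pi> (\<lambda>i\<in>{1..n}. snd (\<omega> (\<phi> i)) $ c)) =
      (LINT x|PiM {1..n} (\<lambda>_. lborel). (\<Prod>i\<in>{1..n}. b i (x i)) * perm_factor q n \<pi> (\<lambda>i\<in>{1..n}. x i $ c))"
    by (intro integral_PiM_transfer[OF sigma_finite_Zm lborel.sigma_finite_measure_axioms s
          finite_atLeastAtMost _ int_a int_b ab measurable_perm_factor[OF q(1)] norm_perm_factor_le[OF q(2)]])
  have "(\<Prod>i=1..n. copy_embed K1 K2 1 (g i) (\<omega> (\<phi> i)) * copy_embed K1 K2 1 (h (\<pi> i)) (\<omega> (\<phi> i))) *
       copy_lift c (2 * n) (\<lambda>j\<in>{1..2 * n}. 1) (\<lambda>_. 1) (\<lambda>j\<in>{1..2 * n}. \<omega> (yvar (deletion_history n n \<pi>) j)) *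
       perm_factor (JQ Q) n \<pi> (\<lambda>i. \<omega> (\<phi> i)) =
      (\<Prod>i\<in>{1..n}. a i (\<omega> (\<phi> i))) * perm_factor q n \<pi> (\<lambda>i\<in>{1..n}. snd (\<omega> (\<phi> i)) $ c)" for \<omega>
  \<comment> \<open>On the first copy \<open>JQ Q\<close> is \<open>Q\<close>. If some letter lies
    elsewhere, the products on both sides vanish.\<close>
  proof (cases "\<forall>i\<in>{1..n}. fst (\<omega> (\<phi> i)) = 1")
    case True
    \<comment> \<open>\<open>copy_lift\<close> tests all \<open>2 * n\<close> variables, and each of
      them is one of the \<open>n\<close> integration letters.\<close>
    have "\<exists>i\<in>{1..n}. yvar (deletion_history n n \<pi>) j = \<phi> i" if j: "j \<in> {1..2 * n}" for j
    proof (cases "j \<le> n")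
      case True
      with j have i: "Suc n - j \<in> {1..n}" "Suc n - (Suc n - j) = j" by auto
      then show ?thesis
        using deletion_history_yvar(1)[OF \<pi> i(1)] by (intro bexI[OF _ i(1)]) (simp add: \<phi>_def)
    next
      case False
      then have "j - n \<in> \<pi> ` {1..n}"
        using j permutes_image[OF \<pi>] by auto
      then obtain i where "i \<in> {1..n}" "j = n + \<pi> i"
        using False by force
      then show ?thesis
        using deletion_history_yvar(2)[OF \<pi>, of i] by (auto simp: \<phi>_def)
    qed
    then have "copy_lift c (2 * n) (\<lambda>j\<in>{1..2 * n}. 1) (\<lambda>_. 1)
        (\<lambda>j\<in>{1..2 * n}. \<omega> (yvar (deletion_history n n \<pi>) j)) = 1"
      using True by (fastforce simp: copy_lift_def)
    moreover have "(\<Prod>i=1..n. copy_embed K1 K2 1 (g i) (\<omega> (\<phi> i)) * copy_embed K1 K2 1 (h (\<pi> i)) (\<omega> (\<phi> i))) =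
        (\<Prod>i\<in>{1..n}. a i (\<omega> (\<phi> i)))"
      by (intro prod.cong) (auto simp: a_def copy_embed_def)
    moreover have "perm_factor (JQ Q) n \<pi> (\<lambda>i. \<omega> (\<phi> i)) =
        perm_factor q n \<pi> (\<lambda>i\<in>{1..n}. snd (\<omega> (\<phi> i)) $ c)"
      using True by (intro perm_factor_cong) (simp add: JQ_def Qq)
    ultimately show ?thesis
      by simp
  next
    case False
    then obtain i where i: "i \<in> {1..n}" "fst (\<omega> (\<phi> i)) \<noteq> 1" by blast
    then have "(\<Prod>i=1..n. copy_embed K1 K2 1 (g i) (\<omega> (\<phi> i)) * copy_embed K1 K2 1 (h (\<pi> i)) (\<omega> (\<phi> i))) = 0"
      by (intro prod_zero bexI[of _ i]) (auto simp: copy_embed_def)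
    moreover have "(\<Prod>i\<in>{1..n}. a i (\<omega> (\<phi> i))) = 0"
      using i by (intro prod_zero bexI[of _ i]) (auto simp: a_def)
    ultimately show ?thesis
      by (simp only: mult_zero_left)
  qed
  moreover have "perm_factor q n \<pi> (\<lambda>i\<in>{1..n}. x i $ c) = perm_factor Q n \<pi> x" for x
    by (intro perm_factor_cong) (simp add: Qq)
  ultimately show ?thesis
    using transfer unfolding \<phi>_def[symmetric] T_def[symmetric] by (simp only: b_def)
qed

theorem corollary25:
  fixes c :: "'d::finite"
    and Q :: "real^'d \<Rightarrow> real^'d \<Rightarrow> complex"
    and \<eta> :: real
    and K1 K2 :: "(real^'d \<Rightarrow> real) \<Rightarrow> (real^'d \<Rightarrow> real)"
    and n :: nat
    and g h :: "nat \<Rightarrow> real^'d \<Rightarrow> complex"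
  assumes "CARD('d) \<ge> 2"
    and "exchange_function c \<eta> Q"
    and "L2_operator lborel K1" and "L2_operator lborel K2"
    and "commutes_with_multiplications c K1" and "commutes_with_multiplications c K2"
    and "\<forall>f\<in>L2 lborel. AE x in lborel.
           L2_adjoint lborel K2 (K2 f) x = f x + \<eta> * L2_adjoint lborel K1 (K1 f) x"
    and "\<forall>i\<in>{1..n}. g i \<in> L2 lborel" and "\<forall>i\<in>{1..n}. h i \<in> L2 lborel"
  shows "n_point c Q K1 K2 n (\<lambda>j. if j \<le> n then g (n + 1 - j) else h (j - n)) (\<lambda>_. 1) =
    (\<Sum>\<pi> | \<pi> permutes {1..n}.
       LINT x|PiM {1..n} (\<lambda>_. lborel).
         (\<Prod>i=1..n. g i (x i) * complexify (\<lambda>f. L2_adjoint lborel K1 (K1 f)) (h (\<pi> i)) (x i))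
         * perm_factor Q n \<pi> x)"
proof -
  \<comment> \<open>The reversed order of the \<open>g\<close> makes step \<open>Suc n - i\<close>
    carry \<open>g i\<close>, which pairs it with \<open>h (\<pi> i)\<close> at step
    \<open>n + \<pi> i\<close>.\<close>
  define f where "f j = (if j \<le> n then g (n + 1 - j) else h (j - n))" for j
  define A where "A = gen_operator c Q K1 K2 (2 * n) (\<lambda>j. if j \<le> n then Plus else Minus) f (\<lambda>_. 1)"
  have "f j \<in> L2 lborel" if "j \<in> {1..2 * n}" for j
  proof (cases "j \<le> n")
    case True
    then have "n + 1 - j \<in> {1..n}" using that by auto
    with True show ?thesis using assms(8) by (simp add: f_def)
  next
    case False
    then have "j - n \<in> {1..n}" using that by auto
    with False show ?thesis using assms(9) by (simp add: f_def)
  qed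
  \<comment> \<open>\<open>vacuum_state\<close> is restricted to the algebra, so membership is
    needed before it can be evaluated.\<close>
  then have "A \<in> gen_algebra c Q K1 K2"
    unfolding A_def by (intro gen_algebra.gen) (auto simp: Linfty_def intro!: exI[of _ 1])
  then have "n_point c Q K1 K2 n f (\<lambda>_. 1) = A fock_vacuum 0 (\<lambda>_. undefined)"
    unfolding n_point_def vacuum_state_def A_def[symmetric] by (simp add: fock_inner_vacuum)
  also have "\<dots> = (\<Sum>\<pi> | \<pi> permutes {1..n}.
       LINT x|PiM {1..n} (\<lambda>_. lborel).
         (\<Prod>i=1..n. g i (x i) * complexify (\<lambda>f. L2_adjoint lborel K1 (K1 f)) (h (\<pi> i)) (x i))
         * perm_factor Q n \<pi> x)"
    unfolding A_def vacuum_expectation_permutations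
  proof (intro sum.cong refl)
    fix \<pi> assume "\<pi> \<in> {\<pi>. \<pi> permutes {1..n}}"
    then have \<pi>: "\<pi> permutes {1..n}" by simp
    have f: "f (Suc n - i) = g i" "f (n + \<pi> i) = h (\<pi> i)" if "i \<in> {1..n}" for i
      using that permutes_in_image[OF \<pi>, of i] by (auto simp: f_def)
    have "(\<Prod>i=1..n. copy_embed K1 K2 1 (f (Suc n - i)) (\<omega> (Created (n + \<pi> i))) *
          copy_embed K1 K2 1 (f (n + \<pi> i)) (\<omega> (Created (n + \<pi> i)))) =
        (\<Prod>i=1..n. copy_embed K1 K2 1 (g i) (\<omega> (Created (n + \<pi> i))) *
          copy_embed K1 K2 1 (h (\<pi> i)) (\<omega> (Created (n + \<pi> i))))" for \<omega>
      by (intro prod.cong refl) (simp only: f)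
    then show "(LINT \<omega>|PiM ((\<lambda>i. Created (n + \<pi> i)) ` {1..n}) (\<lambda>_. Zm).
       (\<Prod>i=1..n. copy_embed K1 K2 1 (f (Suc n - i)) (\<omega> (Created (n + \<pi> i))) *
          copy_embed K1 K2 1 (f (n + \<pi> i)) (\<omega> (Created (n + \<pi> i)))) *
       copy_lift c (2 * n) (\<lambda>j\<in>{1..2 * n}. 1) (\<lambda>_. 1) (\<lambda>j\<in>{1..2 * n}. \<omega> (yvar (deletion_history n n \<pi>) j)) *
       perm_factor (JQ Q) n \<pi> (\<lambda>i. \<omega> (Created (n + \<pi> i)))) =
      (LINT x|PiM {1..n} (\<lambda>_. lborel).
         (\<Prod>i=1..n. g i (x i) * complexify (\<lambda>f. L2_adjoint lborel K1 (K1 f)) (h (\<pi> i)) (x i))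
         * perm_factor Q n \<pi> x)"
      using integral_deletion_history[OF assms(2,3,5) _ _ \<pi>, of g h K2] assms(8,9) by simp
  qed
  finally show ?thesis
    by (simp only: f_def[abs_def])
qed

end
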